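(* (Skew supersymmetry.) Let $V$ be an $N=2$ vertex superalgebra with two odd formal variables. Let $\mathcal{D}^\pm$ be the odd endomorphisms of $V$ defined by $\mathcal{D}^\pm(v)=v^\pm_{-\frac32}\mathbf{1}$, and let $\mathcal{D}=\frac12[\mathcal{D}^+,\mathcal{D}^-]$. Then $$Y(u,(x,\varphi^+,\varphi^-))v=(-1)^{\eta(u)\eta(v)}e^{x\mathcal{D}+\varphi^+\mathcal{D}^++\varphi^-\mathcal{D}^-}Y(v,(-x,-\varphi^+,-\varphi^-))u$$ for $u,v$ of homogeneous sign in $V$.
   Context: Grassmann algebra: $\bigwedge_L$ ($L\in\mathbb{N}$) is the exterior algebra over $\mathbb{C}$ on $L$ generators, $\bigwedge_L\subset\bigwedge_{L+1}$, $\bigwedge_\infty=\bigcup_L\bigwedge_L$; $\bigwedge_*$ is one of these, with even and odd parts $\bigwedge_*^0,\bigwedge_*^1$. For $V=V^0\oplus V^1$ write $\eta(v)=j$ if $v\in V^j$. $[A,B]=AB-(-1)^{\eta(A)\eta(B)}BA$ is the supercommutator. Formal variables: $x,x_0,x_1,x_2$ are even (commute with everything); $\varphi^\pm,\varphi_1^\pm,\varphi_2^\pm$ are odd (commute with even variables and even elements; anticommute with each other, with $\bigwedge_*^1$ and with odd endomorphisms; squares vanish). $\delta(x)=\sum_{n\in\mathbb{Z}}x^n$; expressions containing products of odd variables are Taylor expanded about the even variables, and powers of a sum of two even variables are expanded in nonnegative powers of the second one, e.g. $\delta\big(\frac{x_1-x_2-\nu}{x_0}\big)=\sum_n(x_1-x_2-\nu)^nx_0^{-n}$.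 An $N=2$ vertex superalgebra over $\bigwedge_*$ with two odd formal variables, $(V,Y(\cdot,(x,\varphi^+,\varphi^-)),\mathbf{1})$, consists of a $\mathbb{Z}_2$-graded $\bigwedge_*$-module $V=V^0\oplus V^1$, a linear map $v\mapsto Y(v,(x,\varphi^+,\varphi^-))=\sum_{n\in\mathbb{Z}}(v_n+\varphi^+v^+_{n-\frac12}+\varphi^-v^-_{n-\frac12}+\varphi^+\varphi^-v^{+-}_{n-1})x^{-n-1}\in(\mathrm{End}\,V)[[x,x^{-1}]][\varphi^+,\varphi^-]$ with $v_n,v^{+-}_n\in(\mathrm{End}\,V)^{\eta(v)}$ and $v^\pm_{n-\frac12}\in(\mathrm{End}\,V)^{\eta(v)+1\bmod2}$ for homogeneous $v$, and $\mathbf{1}\in V$, such that for $u,v\in V$: (truncation) $u_nv=u^{+-}_nv=u^\pm_{n-\frac12}v=0$ for $n$ sufficiently large; (vacuum) $Y(\mathbf{1},(x,\varphi^+,\varphi^-))=\mathrm{id}_V$; (creation) $Y(v,(x,\varphi^+,\varphi^-))\mathbf{1}\in V[[x]][\varphi^+,\varphi^-]$ and its value at $(x,\varphi^+,\varphi^-)=0$ is $v$; (Jacobi identity) for $u,v$ of homogeneous sign $$x_0^{-1}\delta\Big(\tfrac{x_1-x_2-\varphi_1^+\varphi_2^--\varphi_1^-\varphi_2^+}{x_0}\Big)Y(u,(x_1,\varphi_1^+,\varphi_1^-))Y(v,(x_2,\varphi_2^+,\varphi_2^-))-(-1)^{\eta(u)\eta(v)}x_0^{-1}\delta\Big(\tfrac{x_2-x_1+\varphi_1^+\varphi_2^-+\varphi_1^-\varphi_2^+}{-x_0}\Big)Y(v,(x_2,\varphi_2^+,\varphi_2^-))Y(u,(x_1,\varphi_1^+,\varphi_1^-))$$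 $$=x_2^{-1}\delta\Big(\tfrac{x_1-x_0-\varphi_1^+\varphi_2^--\varphi_1^-\varphi_2^+}{x_2}\Big)Y(Y(u,(x_0,\varphi_1^+-\varphi_2^+,\varphi_1^--\varphi_2^-))v,(x_2,\varphi_2^+,\varphi_2^-)).$$ *)

theory Defs
  imports
    Complex_Main
    "HOL-Library.Z2"
    "HOL-Library.Extended_Nat"
    "HOL-Library.Poly_Mapping"
begin

section \<open>Grassmann algebras\<close>

text \<open>
  The exterior algebra over the complex numbers on generators indexed by a linearly ordered type.
  An element is given by its coefficients with respect to the basis of ordered monomials
  \<open>e\<^sub>I = e\<^sub>i\<^sub>1 \<cdots> e\<^sub>i\<^sub>k\<close>, where \<open>I = {i\<^sub>1 < \<cdots> < i\<^sub>k}\<close> is a finite set.  One has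
  \<open>e\<^sub>I e\<^sub>J = \<plusminus> e\<^bsub>I \<union> J\<^esub>\<close> if \<open>I\<close> and \<open>J\<close> are disjoint, and \<open>e\<^sub>I e\<^sub>J = 0\<close> otherwise; the sign
  counts the inversions.
\<close>

definition gsign :: "'o::linorder set \<Rightarrow> 'o set \<Rightarrow> complex" where
  "gsign I J = (- 1) ^ card {(i, j). i \<in> I \<and> j \<in> J \<and> j < i}"

lemma gsign_Un_left:
  assumes "finite I" "finite J" "finite M" "I \<inter> J = {}"
  shows "gsign (I \<union> J) M = gsign I M * gsign J M"
proof -
  have eq: "{(i, j). i \<in> I \<union> J \<and> j \<in> M \<and> j < i} =
      {(i, j). i \<in> I \<and> j \<in> M \<and> j < i} \<union> {(i, j). i \<in> J \<and> j \<in> M \<and> j < i}"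
    by auto
  have fin: "finite {(i, j). i \<in> A \<and> j \<in> M \<and> j < i}" if "finite A" for A
    by (rule finite_subset[of _ "A \<times> M"]) (use assms that in auto)
  show ?thesis unfolding gsign_def eq
    by (subst card_Un_disjoint) (use assms fin in \<open>auto simp: power_add\<close>)
qed

lemma gsign_Un_right:
  assumes "finite I" "finite J" "finite M" "J \<inter> M = {}"
  shows "gsign I (J \<union> M) = gsign I J * gsign I M"
proof -
  have eq: "{(i, j). i \<in> I \<and> j \<in> J \<union> M \<and> j < i} =
      {(i, j). i \<in> I \<and> j \<in> J \<and> j < i} \<union> {(i, j). i \<in> I \<and> j \<in> M \<and> j < i}"
    by auto
  have fin: "finite {(i, j). i \<in> I \<and> j \<in> A \<and> j < i}" if "finite A" for A
    by (rule finite_subset[of _ "I \<times> A"]) (use assms that in auto)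
  show ?thesis unfolding gsign_def eq
    by (subst card_Un_disjoint) (use assms fin in \<open>auto simp: power_add\<close>)
qed

lemma gsign_empty [simp]: "gsign {} J = 1" "gsign I {} = 1"
  by (simp_all add: gsign_def)

typedef 'o grassmann =
  "{f :: 'o set \<Rightarrow> complex. finite {I. f I \<noteq> 0} \<and> (\<forall>I. f I \<noteq> 0 \<longrightarrow> finite I)}"
  morphisms gcoeff Abs_grassmann
  by (rule exI[of _ "\<lambda>_. 0"]) simp

setup_lifting type_definition_grassmann

lift_definition gconst :: "complex \<Rightarrow> 'o grassmann" is
  "\<lambda>c I. if I = {} then c else 0"
  by (auto split: if_splits)

lift_definition gen :: "'o \<Rightarrow> 'o grassmann" is
  "\<lambda>i I. if I = {i} then 1 else 0"
  by (auto split: if_splits)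

lift_definition gmonom :: "'o::finite set \<Rightarrow> 'o grassmann" is
  "\<lambda>K I. if I = K then 1 else 0"
  by (auto split: if_splits)

instantiation grassmann :: (linorder) ring_1
begin

lift_definition zero_grassmann :: "'a grassmann" is "\<lambda>_. 0" by simp

lift_definition one_grassmann :: "'a grassmann" is "\<lambda>I. if I = {} then 1 else 0"
  by (auto split: if_splits)

lift_definition plus_grassmann :: "'a grassmann \<Rightarrow> 'a grassmann \<Rightarrow> 'a grassmann" is
  "\<lambda>f g I. f I + g I"
proof -
  fix f g :: "'a set \<Rightarrow> complex"
  assume *: "finite {I. f I \<noteq> 0} \<and> (\<forall>I. f I \<noteq> 0 \<longrightarrow> finite I)"
    "finite {I. g I \<noteq> 0} \<and> (\<forall>I. g I \<noteq> 0 \<longrightarrow> finite I)"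
  have "finite {I. f I + g I \<noteq> 0}"
    by (rule finite_subset[of _ "{I. f I \<noteq> 0} \<union> {I. g I \<noteq> 0}"]) (use * in auto)
  then show "finite {I. f I + g I \<noteq> 0} \<and> (\<forall>I. f I + g I \<noteq> 0 \<longrightarrow> finite I)"
    using * by (metis add.right_neutral)
qed

lift_definition uminus_grassmann :: "'a grassmann \<Rightarrow> 'a grassmann" is "\<lambda>f I. - f I"
  by simp

lift_definition minus_grassmann :: "'a grassmann \<Rightarrow> 'a grassmann \<Rightarrow> 'a grassmann" is
  "\<lambda>f g I. f I - g I"
proof -
  fix f g :: "'a set \<Rightarrow> complex"
  assume *: "finite {I. f I \<noteq> 0} \<and> (\<forall>I. f I \<noteq> 0 \<longrightarrow> finite I)"
    "finite {I. g I \<noteq> 0} \<and> (\<forall>I. g I \<noteq> 0 \<longrightarrow> finite I)"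
  have "finite {I. f I - g I \<noteq> 0}"
    by (rule finite_subset[of _ "{I. f I \<noteq> 0} \<union> {I. g I \<noteq> 0}"]) (use * in auto)
  then show "finite {I. f I - g I \<noteq> 0} \<and> (\<forall>I. f I - g I \<noteq> 0 \<longrightarrow> finite I)"
    using * by (metis diff_zero)
qed

lift_definition times_grassmann :: "'a grassmann \<Rightarrow> 'a grassmann \<Rightarrow> 'a grassmann" is
  "\<lambda>f g K. \<Sum>I\<in>Pow K. gsign I (K - I) * f I * g (K - I)"
proof -
  fix f g :: "'a set \<Rightarrow> complex"
  assume *: "finite {I. f I \<noteq> 0} \<and> (\<forall>I. f I \<noteq> 0 \<longrightarrow> finite I)"
    "finite {I. g I \<noteq> 0} \<and> (\<forall>I. g I \<noteq> 0 \<longrightarrow> finite I)"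
  let ?h = "\<lambda>K. \<Sum>I\<in>Pow K. gsign I (K - I) * f I * g (K - I)"
  have "K \<in> (\<lambda>(I, J). I \<union> J) ` ({I. f I \<noteq> 0} \<times> {I. g I \<noteq> 0})" if "?h K \<noteq> 0" for K
  proof -
    obtain I where "I \<subseteq> K" "gsign I (K - I) * f I * g (K - I) \<noteq> 0"
      using \<open>?h K \<noteq> 0\<close> by (meson PowD sum.not_neutral_contains_not_neutral)
    then show ?thesis
      by (intro image_eqI[of _ _ "(I, K - I)"]) auto
  qed
  then have "{K. ?h K \<noteq> 0} \<subseteq> (\<lambda>(I, J). I \<union> J) ` ({I. f I \<noteq> 0} \<times> {I. g I \<noteq> 0})" by blast
  then have "finite {K. ?h K \<noteq> 0}"
    by (rule finite_subset) (use * in auto)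
  moreover have "finite K" if "?h K \<noteq> 0" for K
    using that by (metis finite_Pow_iff sum.infinite)
  ultimately show "finite {K. ?h K \<noteq> 0} \<and> (\<forall>K. ?h K \<noteq> 0 \<longrightarrow> finite K)" by blast
qed

instance
proof
  fix a b c :: "'a grassmann"
  show "a + b + c = a + (b + c)" by transfer (simp add: add.assoc)
  show "a + b = b + a" by transfer (simp add: add.commute)
  show "0 + a = a" by transfer simp
  show "- a + a = 0" by transfer simp
  show "a - b = a + - b" by transfer simp
  show "(a + b) * c = a * c + b * c"
    by transfer (auto simp: algebra_simps sum.distrib)
  show "a * (b + c) = a * b + a * c"
    by transfer (auto simp: algebra_simps sum.distrib)
  show "(0 :: 'a grassmann) \<noteq> 1" by transfer (metis zero_neq_one)
  show "1 * a = a"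
  proof (transfer, rule ext)
    fix f :: "'a set \<Rightarrow> complex" and K
    assume f: "finite {I. f I \<noteq> 0} \<and> (\<forall>I. f I \<noteq> 0 \<longrightarrow> finite I)"
    show "(\<Sum>I\<in>Pow K. gsign I (K - I) * (if I = {} then 1 else 0) * f (K - I)) = f K"
    proof (cases "finite K")
      case True
      have "(\<Sum>I\<in>Pow K. gsign I (K - I) * (if I = {} then 1 else 0) * f (K - I)) =
          (\<Sum>I\<in>Pow K. if I = {} then f K else 0)"
        by (rule sum.cong) auto
      then show ?thesis using True by simp
    next
      case False
      then show ?thesis using f by auto
    qed
  qed
  show "a * 1 = a"
  proof (transfer, rule ext)
    fix f :: "'a set \<Rightarrow> complex" and K
    assume f: "finite {I. f I \<noteq> 0} \<and> (\<forall>I. f I \<noteq> 0 \<longrightarrow> finite I)"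
    show "(\<Sum>I\<in>Pow K. gsign I (K - I) * f I * (if K - I = {} then 1 else 0)) = f K"
    proof (cases "finite K")
      case True
      have "(\<Sum>I\<in>Pow K. gsign I (K - I) * f I * (if K - I = {} then 1 else 0)) =
          (\<Sum>I\<in>Pow K. if I = K then f K else 0)"
        by (rule sum.cong) auto
      then show ?thesis using True by simp
    next
      case False
      then show ?thesis using f by auto
    qed
  qed
  show "a * b * c = a * (b * c)"
  proof (transfer, rule ext)
    fix f g h :: "'a set \<Rightarrow> complex" and K :: "'a set"
    let ?lhs = "\<Sum>I\<in>Pow K. gsign I (K - I) *
        (\<Sum>J\<in>Pow I. gsign J (I - J) * f J * g (I - J)) * h (K - I)"
    let ?rhs = "\<Sum>J\<in>Pow K. gsign J (K - J) * f J *
        (\<Sum>M\<in>Pow (K - J). gsign M (K - J - M) * g M * h (K - J - M))"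
    show "?lhs = ?rhs"
    proof (cases "finite K")
      case True
      have "?lhs = (\<Sum>(I, J)\<in>Sigma (Pow K) Pow.
          gsign I (K - I) * (gsign J (I - J) * f J * g (I - J)) * h (K - I))"
        using True by (simp add: sum.Sigma finite_subset sum_distrib_left sum_distrib_right)
      also have "\<dots> = (\<Sum>(J, M)\<in>Sigma (Pow K) (\<lambda>J. Pow (K - J)).
          gsign J (K - J) * f J * (gsign M (K - J - M) * g M * h (K - J - M)))"
      proof (rule sum.reindex_bij_witness[where
            i = "\<lambda>(J, M). (J \<union> M, J)" and j = "\<lambda>(I, J). (J, I - J)"])
        fix p assume p: "p \<in> Sigma (Pow K) Pow"
        obtain I J where IJ: "p = (I, J)" by force
        have sub: "J \<subseteq> I" "I \<subseteq> K" using p IJ by auto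
        have fin: "finite I" "finite J" "finite (I - J)" "finite (K - I)"
          using True sub by (auto intro: finite_subset)
        have "gsign I (K - I) = gsign J (K - I) * gsign (I - J) (K - I)"
          using gsign_Un_left[of J "I - J" "K - I"] fin sub by (simp add: Un_absorb1)
        moreover have "K - J = (I - J) \<union> (K - I)" using sub by auto
        then have "gsign J (K - J) = gsign J (I - J) * gsign J (K - I)"
          using gsign_Un_right[of J "I - J" "K - I"] fin by auto
        moreover have "K - J - (I - J) = K - I" using sub by auto
        ultimately show "(case case p of (I, J) \<Rightarrow> (J, I - J) of (J, M) \<Rightarrow>
            gsign J (K - J) * f J * (gsign M (K - J - M) * g M * h (K - J - M))) =
          (case p of (I, J) \<Rightarrow>
            gsign I (K - I) * (gsign J (I - J) * f J * g (I - J)) * h (K - I))"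
          by (simp add: IJ)
      qed auto
      also have "\<dots> = ?rhs"
        using True by (simp add: sum.Sigma finite_subset sum_distrib_left)
      finally show ?thesis .
    next
      case False
      then show ?thesis by (simp add: sum.infinite)
    qed
  qed
qed

end

lemma gen_anticommute: "gen i * gen j = - (gen j * gen i :: 'a::linorder grassmann)"
proof (transfer, rule ext)
  fix i j :: 'a and K
  have *: "(\<Sum>I\<in>Pow K. gsign I (K - I) * (if I = {a} then 1 else 0) * (if K - I = {b} then 1 else 0))
    = (if K = {a,b} \<and> a \<noteq> b then (if b < a then -1 else 1) else 0)" for a b :: 'a
  proof (cases "finite K \<and> {a} \<subseteq> K")
    case True
    have "(\<Sum>I\<in>Pow K. gsign I (K - I) * (if I = {a} then 1 else 0) * (if K - I = {b} then 1 else 0))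
     = (\<Sum>I\<in>Pow K. if I = {a} then gsign {a} (K-{a}) * (if K - {a} = {b} then 1 else 0) else 0)"
      by (rule sum.cong) auto
    also have "\<dots> = gsign {a} (K-{a}) * (if K - {a} = {b} then 1 else 0)" using True by simp
    also have "\<dots> = (if K = {a,b} \<and> a \<noteq> b then (if b < a then -1 else 1) else 0)"
    proof (cases "K - {a} = {b}")
      case t: True
      have "{(i, j). i \<in> {a} \<and> j \<in> {b} \<and> j < i} = (if b < a then {(a,b)} else {})" by auto
      then have "gsign {a} {b} = (if b < a then -1 else 1)" unfolding gsign_def by simp
      then show ?thesis using t True by auto
    next
      case False then show ?thesis using True by auto
    qed
    finally show ?thesis .
  next
    case False
    then have "infinite (Pow K) \<or> (\<forall>I\<in>Pow K. I \<noteq> {a})" by auto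
    then have "(\<Sum>I\<in>Pow K. gsign I (K - I) * (if I = {a} then 1 else 0) *
        (if K - I = {b} then 1 else 0)) = 0"
    proof
      assume "\<forall>I\<in>Pow K. I \<noteq> {a}"
      then show ?thesis by (intro sum.neutral) simp
    qed simp
    moreover have "K \<noteq> {a, b}" using False by auto
    ultimately show ?thesis by simp
  qed
  show "(\<Sum>I\<in>Pow K. gsign I (K - I) * (if I = {i} then 1 else 0) * (if K - I = {j} then 1 else 0)) =
       - (\<Sum>I\<in>Pow K. gsign I (K - I) * (if I = {j} then 1 else 0) * (if K - I = {i} then 1 else 0))"
    unfolding * by (auto simp: insert_commute)
qed

text \<open>
  \<open>Lambda L\<close> is the exterior algebra on the first \<open>L\<close> generators, and \<open>Lambda \<infinity>\<close> is the union of
  these for finite \<open>L\<close>.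
\<close>

definition Lambda :: "enat \<Rightarrow> nat grassmann set" where
  "Lambda L = {a. \<forall>I i. gcoeff a I \<noteq> 0 \<longrightarrow> i \<in> I \<longrightarrow> enat i < L}"

text \<open>Parities are elements of \<open>\<int>/2\<close>, the type \<^typ>\<open>bit\<close>.\<close>

definition Lambda_part :: "enat \<Rightarrow> bit \<Rightarrow> nat grassmann set" where
  "Lambda_part L p = {a \<in> Lambda L. \<forall>I. gcoeff a I \<noteq> 0 \<longrightarrow> of_nat (card I) = p}"

definition psign :: "bit \<Rightarrow> complex" where
  "psign p = (if p = 0 then 1 else - 1)"


section \<open>Graded modules and their endomorphisms\<close>

text \<open>
  The components \<open>md v n\<close>, \<open>mdp v n\<close>, \<open>mdm v n\<close>, \<open>mdpm v n\<close> are the coefficients of \<open>x\<^bsup>-n-1\<^esup>\<close>,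
  \<open>\<phi>\<^sup>+ x\<^bsup>-n-1\<^esup>\<close>, \<open>\<phi>\<^sup>- x\<^bsup>-n-1\<^esup>\<close>, \<open>\<phi>\<^sup>+\<phi>\<^sup>- x\<^bsup>-n-1\<^esup>\<close> in \<open>Y(v,(x,\<phi>\<^sup>+,\<phi>\<^sup>-))\<close>.  In the usual notation they are
  \<open>v\<^bsub>n\<^esub>\<close>, \<open>v\<^sup>+\<^bsub>n-1/2\<^esub>\<close>, \<open>v\<^sup>-\<^bsub>n-1/2\<^esub>\<close>, \<open>v\<^sup>+\<^sup>-\<^bsub>n-1\<^esub>\<close>, so the index shown here is shifted by \<open>1/2\<close> for the
  second and third and by \<open>1\<close> for the fourth.
\<close>

record 'v n2_data =
  act :: "nat grassmann \<Rightarrow> 'v \<Rightarrow> 'v"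
  gr :: "bit \<Rightarrow> 'v set"
  md :: "'v \<Rightarrow> int \<Rightarrow> 'v \<Rightarrow> 'v"
  mdp :: "'v \<Rightarrow> int \<Rightarrow> 'v \<Rightarrow> 'v"
  mdm :: "'v \<Rightarrow> int \<Rightarrow> 'v \<Rightarrow> 'v"
  mdpm :: "'v \<Rightarrow> int \<Rightarrow> 'v \<Rightarrow> 'v"
  vac :: 'v

definition csc :: "'v n2_data \<Rightarrow> complex \<Rightarrow> 'v \<Rightarrow> 'v" where
  "csc V c v = act V (gconst c) v"

locale graded_Lambda_module =
  fixes L :: enat and V :: "('v::ab_group_add) n2_data"
  assumes act_add_right: "a \<in> Lambda L \<Longrightarrow> act V a (v + w) = act V a v + act V a w"
    and act_add_left:
      "a \<in> Lambda L \<Longrightarrow> b \<in> Lambda L \<Longrightarrow> act V (a + b) v = act V a v + act V b v"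
    and act_mult: "a \<in> Lambda L \<Longrightarrow> b \<in> Lambda L \<Longrightarrow> act V (a * b) v = act V a (act V b v)"
    and act_one: "act V 1 v = v"
    and gr_zero: "0 \<in> gr V p"
    and gr_add: "v \<in> gr V p \<Longrightarrow> w \<in> gr V p \<Longrightarrow> v + w \<in> gr V p"
    and gr_act: "a \<in> Lambda_part L q \<Longrightarrow> v \<in> gr V p \<Longrightarrow> act V a v \<in> gr V (q + p)"
    and gr_direct_sum: "\<exists>!(v0, v1). v0 \<in> gr V 0 \<and> v1 \<in> gr V 1 \<and> v = v0 + v1"

text \<open>
  \<open>End_part L V p\<close> consists of the endomorphisms of the graded module that are homogeneous of
  parity \<open>p\<close>.  Linearity over the Grassmann algebra is subject to the usual rule of signs: odd
  endomorphisms anticommute with the action of odd elements.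
\<close>

definition End_part :: "enat \<Rightarrow> ('v::ab_group_add) n2_data \<Rightarrow> bit \<Rightarrow> ('v \<Rightarrow> 'v) set" where
  "End_part L V p = {f.
     (\<forall>v w. f (v + w) = f v + f w) \<and>
     (\<forall>q. \<forall>a\<in>Lambda_part L q. \<forall>v. f (act V a v) = csc V (psign (p * q)) (act V a (f v))) \<and>
     (\<forall>q. \<forall>v\<in>gr V q. f v \<in> gr V (p + q))}"

definition supercommutator ::
    "('v::ab_group_add) n2_data \<Rightarrow> bit \<Rightarrow> bit \<Rightarrow> ('v \<Rightarrow> 'v) \<Rightarrow> ('v \<Rightarrow> 'v) \<Rightarrow> 'v \<Rightarrow> 'v" where
  \<comment> \<open>\<open>p\<close> and \<open>q\<close> are the parities of \<open>A\<close> and \<open>B\<close>\<close>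
  "supercommutator V p q A B v = A (B v) - csc V (psign (p * q)) (B (A v))"


section \<open>Formal series\<close>

datatype evar = Var_x | Var_x0 | Var_x1 | Var_x2

datatype ovar = Phi_p | Phi_m | Phi1_p | Phi1_m | Phi2_p | Phi2_m

instance ovar :: finite
proof
  have "(UNIV :: ovar set) = {Phi_p, Phi_m, Phi1_p, Phi1_m, Phi2_p, Phi2_m}"
    using ovar.exhaust by auto
  then show "finite (UNIV :: ovar set)" by (metis finite.emptyI finite_insert)
qed

instantiation ovar :: linorder
begin

primrec ovar_index :: "ovar \<Rightarrow> nat" where
  "ovar_index Phi_p = 0"
| "ovar_index Phi_m = 1"
| "ovar_index Phi1_p = 2"
| "ovar_index Phi1_m = 3"
| "ovar_index Phi2_p = 4"
| "ovar_index Phi2_m = 5"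

definition less_eq_ovar :: "ovar \<Rightarrow> ovar \<Rightarrow> bool" where
  "less_eq_ovar a b \<longleftrightarrow> ovar_index a \<le> ovar_index b"

definition less_ovar :: "ovar \<Rightarrow> ovar \<Rightarrow> bool" where
  "less_ovar a b \<longleftrightarrow> ovar_index a < ovar_index b"

lemma ovar_index_inject: "ovar_index a = ovar_index b \<Longrightarrow> a = b"
  by (cases a; cases b) simp_all

instance
  by standard (auto simp: less_eq_ovar_def less_ovar_def intro: ovar_index_inject)

end

text \<open>
  All series are in the same set of variables.  A series \<open>F :: 'v fser\<close> stands for
  \<open>\<Sum> x\<^sup>e \<phi>\<^sub>K F e K\<close>, where \<open>e\<close> runs over the integer exponents of the even variables and \<open>\<phi>\<^sub>K\<close> is the
  ordered product of the odd variables in \<open>K\<close>; the coefficients are written to the right of the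
  variables.  Infinite sums are taken coefficientwise with \<^const>\<open>Sum_any\<close>, the sum of all the
  nonzero terms if there are only finitely many of these.
\<close>

type_synonym evexp = "evar \<Rightarrow>\<^sub>0 int"
type_synonym 'v fser = "evexp \<Rightarrow> ovar set \<Rightarrow> 'v"
type_synonym cser = "evexp \<Rightarrow> ovar grassmann"

definition const_ser :: "('v::zero) \<Rightarrow> 'v fser" where
  "const_ser v = (\<lambda>e K. if e = 0 \<and> K = {} then v else 0)"

definition csc_ser :: "('v::ab_group_add) n2_data \<Rightarrow> complex \<Rightarrow> 'v fser \<Rightarrow> 'v fser" where
  "csc_ser V c F = (\<lambda>e K. csc V c (F e K))"

definition xmult :: "evar \<Rightarrow> int \<Rightarrow> ('v::ab_group_add) fser \<Rightarrow> 'v fser" where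
  "xmult x m F = (\<lambda>e. F (e - Poly_Mapping.single x m))"

text \<open>Left multiplication by a polynomial in the odd variables.\<close>

definition omult :: "('v::ab_group_add) n2_data \<Rightarrow> ovar grassmann \<Rightarrow> 'v fser \<Rightarrow> 'v fser" where
  "omult V g F = (\<lambda>e K. \<Sum>I\<in>Pow K. csc V (gsign I (K - I) * gcoeff g I) (F e (K - I)))"

definition ser_mult :: "('v::ab_group_add) n2_data \<Rightarrow> cser \<Rightarrow> 'v fser \<Rightarrow> 'v fser" where
  "ser_mult V P F = (\<lambda>e K. Sum_any (\<lambda>m. omult V (P m) F (e - m) K))"

text \<open>
  Action on series of an endomorphism \<open>f\<close> of parity \<open>p\<close>: if \<open>f\<close> is odd, it anticommutes with the
  odd variables.
\<close>

definition End_ser ::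
    "('v::ab_group_add) n2_data \<Rightarrow> bit \<Rightarrow> ('v \<Rightarrow> 'v) \<Rightarrow> 'v fser \<Rightarrow> 'v fser" where
  "End_ser V p f F = (\<lambda>e K. csc V (psign (p * of_nat (card K))) (f (F e K)))"

text \<open>The exponential \<open>\<Sum> T\<^sup>k/k!\<close> of an operator on series.\<close>

definition exp_ser ::
    "('v::ab_group_add) n2_data \<Rightarrow> ('v fser \<Rightarrow> 'v fser) \<Rightarrow> 'v fser \<Rightarrow> 'v fser" where
  "exp_ser V T F = (\<lambda>e K. Sum_any (\<lambda>k. csc V (1 / fact k) ((T ^^ k) F e K)))"

text \<open>
  \<open>bin_pow x t y m\<close> is \<open>(x + t y)\<^sup>m\<close>, expanded in nonnegative powers of \<open>y\<close>, and
  \<open>shift_pow x t y \<nu> n\<close> is \<open>(x + t y + \<nu>)\<^sup>n\<close> for an even polynomial \<open>\<nu>\<close> without constant term in the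
  odd variables, Taylor expanded about \<open>x + t y\<close>; so the \<open>k\<close>-th term is
  \<open>\<nu>\<^sup>k/k!\<close> times the \<open>k\<close>-th derivative of the \<open>n\<close>-th power.
  \<open>delta_ser z r x t y \<nu>\<close> is \<open>z\<^bsup>-1\<^esup> \<delta>((x + t y + \<nu>) / (r z))\<close>.
\<close>

definition bin_pow :: "evar \<Rightarrow> complex \<Rightarrow> evar \<Rightarrow> int \<Rightarrow> evexp \<Rightarrow> complex" where
  "bin_pow x t y m = (\<lambda>e. Sum_any (\<lambda>j::nat.
     if e = Poly_Mapping.single x (m - int j) + Poly_Mapping.single y (int j)
     then (of_int m gchoose j) * t ^ j else 0))"

definition shift_pow ::
    "evar \<Rightarrow> complex \<Rightarrow> evar \<Rightarrow> ovar grassmann \<Rightarrow> int \<Rightarrow> cser" where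
  "shift_pow x t y \<nu> n = (\<lambda>e. Sum_any (\<lambda>k::nat.
     gconst ((of_int n gchoose k) * bin_pow x t y (n - int k) e) * \<nu> ^ k))"

definition delta_ser ::
    "evar \<Rightarrow> complex \<Rightarrow> evar \<Rightarrow> complex \<Rightarrow> evar \<Rightarrow> ovar grassmann \<Rightarrow> cser" where
  "delta_ser z r x t y \<nu> = (\<lambda>e. Sum_any (\<lambda>n::int.
     gconst (r powi (- n)) * shift_pow x t y \<nu> n (e - Poly_Mapping.single z (- n - 1))))"


section \<open>Vertex operators\<close>

text \<open>
  \<open>vop V p v c x \<theta>\<^sup>+ \<theta>\<^sup>-\<close> is \<open>Y(v,(c x, \<theta>\<^sup>+, \<theta>\<^sup>-))\<close>, acting on series, for \<open>v\<close> of parity \<open>p\<close>, a nonzero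
  number \<open>c\<close> and linear combinations \<open>\<theta>\<^sup>+\<close>, \<open>\<theta>\<^sup>-\<close> of odd variables.
\<close>

definition vop :: "('v::ab_group_add) n2_data \<Rightarrow> bit \<Rightarrow> 'v \<Rightarrow> complex \<Rightarrow> evar \<Rightarrow>
    ovar grassmann \<Rightarrow> ovar grassmann \<Rightarrow> 'v fser \<Rightarrow> 'v fser" where
  "vop V p v c x \<theta>p \<theta>m F = (\<lambda>e K. Sum_any (\<lambda>n::int.
     csc_ser V (c powi (- n - 1)) (xmult x (- n - 1) (\<lambda>e K.
         End_ser V p (md V v n) F e K
       + omult V \<theta>p (End_ser V (p + 1) (mdp V v n) F) e K
       + omult V \<theta>m (End_ser V (p + 1) (mdm V v n) F) e K
       + omult V (\<theta>p * \<theta>m) (End_ser V p (mdpm V v n) F) e K)) e K))"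

text \<open>
  The same with a series \<open>A = \<Sum> x\<^bsup>e'\<^esup> \<phi>\<^sub>I A\<^bsub>e',I\<^esub>\<close> of total parity \<open>p\<close> in place of \<open>v\<close>:
  \<open>Y(A,\<dots>) = \<Sum> x\<^bsup>e'\<^esup> \<phi>\<^sub>I Y(A\<^bsub>e',I\<^esub>,\<dots>)\<close>, where \<open>A\<^bsub>e',I\<^esub>\<close> has parity \<open>p + |I|\<close>.
\<close>

definition vop_ser :: "('v::ab_group_add) n2_data \<Rightarrow> bit \<Rightarrow> 'v fser \<Rightarrow> complex \<Rightarrow> evar \<Rightarrow>
    ovar grassmann \<Rightarrow> ovar grassmann \<Rightarrow> 'v fser \<Rightarrow> 'v fser" where
  "vop_ser V p A c x \<theta>p \<theta>m F = (\<lambda>e K. Sum_any (\<lambda>(e', I).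
     omult V (gmonom I) (vop V (p + of_nat (card I)) (A e' I) c x \<theta>p \<theta>m F) (e - e') K))"

definition nu12 :: "ovar grassmann" where
  "nu12 = gen Phi1_p * gen Phi2_m + gen Phi1_m * gen Phi2_p"

text \<open>
  In \<open>mode_add\<close> and \<open>mode_act\<close>, the map \<open>v \<mapsto> Y(v,(x,\<phi>\<^sup>+,\<phi>\<^sup>-))\<close> is linear over the Grassmann algebra:
  \<open>Y(a v,(x,\<phi>\<^sup>+,\<phi>\<^sup>-)) = a Y(v,(x,\<phi>\<^sup>+,\<phi>\<^sup>-))\<close>.  The signs come from moving \<open>a\<close> past \<open>\<phi>\<^sup>\<plusminus>\<close>.
\<close>

locale N2_vertex_superalgebra = graded_Lambda_module L V
  for L :: enat and V :: "('v::ab_group_add) n2_data" +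
  assumes mode_add:
      "md V (v + w) n z = md V v n z + md V w n z"
      "mdp V (v + w) n z = mdp V v n z + mdp V w n z"
      "mdm V (v + w) n z = mdm V v n z + mdm V w n z"
      "mdpm V (v + w) n z = mdpm V v n z + mdpm V w n z"
    and mode_act: "a \<in> Lambda_part L q \<Longrightarrow> md V (act V a v) n z = act V a (md V v n z)"
      "a \<in> Lambda_part L q \<Longrightarrow> mdp V (act V a v) n z = csc V (psign q) (act V a (mdp V v n z))"
      "a \<in> Lambda_part L q \<Longrightarrow> mdm V (act V a v) n z = csc V (psign q) (act V a (mdm V v n z))"
      "a \<in> Lambda_part L q \<Longrightarrow> mdpm V (act V a v) n z = act V a (mdpm V v n z)"
    and mode_End:
      "v \<in> gr V p \<Longrightarrow> md V v n \<in> End_part L V p"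
      "v \<in> gr V p \<Longrightarrow> mdp V v n \<in> End_part L V (p + 1)"
      "v \<in> gr V p \<Longrightarrow> mdm V v n \<in> End_part L V (p + 1)"
      "v \<in> gr V p \<Longrightarrow> mdpm V v n \<in> End_part L V p"
    and truncation: "\<exists>N. \<forall>n\<ge>N.
      md V u n v = 0 \<and> mdp V u n v = 0 \<and> mdm V u n v = 0 \<and> mdpm V u n v = 0"
    and vacuum:
      "md V (vac V) n v = (if n = - 1 then v else 0)"
      "mdp V (vac V) n v = 0" "mdm V (vac V) n v = 0" "mdpm V (vac V) n v = 0"
    and creation:
      "n \<ge> 0 \<Longrightarrow> md V v n (vac V) = 0"
      "n \<ge> 0 \<Longrightarrow> mdp V v n (vac V) = 0"
      "n \<ge> 0 \<Longrightarrow> mdm V v n (vac V) = 0"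
      "n \<ge> 0 \<Longrightarrow> mdpm V v n (vac V) = 0"
      "md V v (- 1) (vac V) = v"
    and Jacobi: "u \<in> gr V j \<Longrightarrow> v \<in> gr V k \<Longrightarrow>
      ser_mult V (delta_ser Var_x0 1 Var_x1 (- 1) Var_x2 (- nu12))
        (vop V j u 1 Var_x1 (gen Phi1_p) (gen Phi1_m)
          (vop V k v 1 Var_x2 (gen Phi2_p) (gen Phi2_m) (const_ser w)))
      - csc_ser V (psign (j * k))
        (ser_mult V (delta_ser Var_x0 (- 1) Var_x2 (- 1) Var_x1 nu12)
          (vop V k v 1 Var_x2 (gen Phi2_p) (gen Phi2_m)
            (vop V j u 1 Var_x1 (gen Phi1_p) (gen Phi1_m) (const_ser w))))
      = ser_mult V (delta_ser Var_x2 1 Var_x1 (- 1) Var_x0 (- nu12))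
        (vop_ser V (j + k)
          (vop V j u 1 Var_x0 (gen Phi1_p - gen Phi2_p) (gen Phi1_m - gen Phi2_m) (const_ser v))
          1 Var_x2 (gen Phi2_p) (gen Phi2_m) (const_ser w))"

text \<open>\<open>\<D>\<^sup>\<plusminus>(v) = v\<^sup>\<plusminus>\<^bsub>-3/2\<^esub> \<one>\<close>; recall that \<open>v\<^sup>\<plusminus>\<^bsub>n-1/2\<^esub>\<close> is stored at index \<open>n\<close>.\<close>

definition Dp :: "('v::ab_group_add) n2_data \<Rightarrow> 'v \<Rightarrow> 'v" where
  "Dp V v = mdp V v (- 1) (vac V)"

definition Dm :: "('v::ab_group_add) n2_data \<Rightarrow> 'v \<Rightarrow> 'v" where
  "Dm V v = mdm V v (- 1) (vac V)"

definition DD :: "('v::ab_group_add) n2_data \<Rightarrow> 'v \<Rightarrow> 'v" where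
  "DD V v = csc V (1 / 2) (supercommutator V 1 1 (Dp V) (Dm V) v)"

text \<open>The operator \<open>x \<D> + \<phi>\<^sup>+ \<D>\<^sup>+ + \<phi>\<^sup>- \<D>\<^sup>-\<close> on series.\<close>

definition Dgen :: "('v::ab_group_add) n2_data \<Rightarrow> 'v fser \<Rightarrow> 'v fser" where
  "Dgen V F = (\<lambda>e K.
     xmult Var_x 1 (End_ser V 0 (DD V) F) e K
     + omult V (gen Phi_p) (End_ser V 1 (Dp V) F) e K
     + omult V (gen Phi_m) (End_ser V 1 (Dm V) F) e K)"

context graded_Lambda_module
begin

lemma act_minus_one: "act V (- 1) v = - v"
proof -
  have one: "1 \<in> Lambda L" "- 1 \<in> Lambda L"
    by (auto simp: Lambda_def one_grassmann.rep_eq uminus_grassmann.rep_eq split: if_splits)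
  have "0 \<in> Lambda L" by (auto simp: Lambda_def zero_grassmann.rep_eq)
  then have zero: "act V 0 v = 0"
    using act_add_left[of 0 0 v] by simp
  have "act V (1 + - 1) v = act V 1 v + act V (- 1) v"
    using one by (rule act_add_left)
  then show ?thesis using zero act_one by (simp add: eq_neg_iff_add_eq_0 add.commute)
qed

lemma gr_minus: "v \<in> gr V p \<Longrightarrow> - v \<in> gr V p"
proof -
  have "- 1 \<in> Lambda_part L 0"
    by (auto simp: Lambda_part_def Lambda_def one_grassmann.rep_eq uminus_grassmann.rep_eq
        split: if_splits)
  then show "v \<in> gr V p \<Longrightarrow> - v \<in> gr V p"
    using gr_act[of "- 1" 0 v p] act_minus_one by (metis add_0)
qed

lemma gr_Int: "v \<in> gr V p \<Longrightarrow> v \<in> gr V (p + 1) \<Longrightarrow> v = 0"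
proof -
  assume "v \<in> gr V p" "v \<in> gr V (p + 1)"
  then have "v \<in> gr V 0" "v \<in> gr V 1" by (cases p; simp)+
  then have "(case (v, 0) of (v0, v1) \<Rightarrow> v0 \<in> gr V 0 \<and> v1 \<in> gr V 1 \<and> v = v0 + v1)"
    "(case (0, v) of (v0, v1) \<Rightarrow> v0 \<in> gr V 0 \<and> v1 \<in> gr V 1 \<and> v = v0 + v1)"
    using gr_zero by auto
  then show "v = 0" using gr_direct_sum[of v] by blast
qed

end

context N2_vertex_superalgebra
begin

lemma End_part_gr: "f \<in> End_part L V p \<Longrightarrow> v \<in> gr V q \<Longrightarrow> f v \<in> gr V (p + q)"
  by (simp add: End_part_def)

lemma vac_even: "vac V \<in> gr V 0"
proof -
  obtain a b where ab: "a \<in> gr V 0" "b \<in> gr V 1" "vac V = a + b"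
    using gr_direct_sum[of "vac V"] by auto
  have hom: "md V b (- 1) w = 0" if w: "w \<in> gr V p" for w p
  proof -
    have "w = md V a (- 1) w + md V b (- 1) w"
      using vacuum(1)[of "- 1" w] mode_add(1)[of a b] ab by simp
    then have "md V b (- 1) w = w + - md V a (- 1) w" by (simp add: algebra_simps)
    moreover have "md V a (- 1) w \<in> gr V p"
      using End_part_gr[OF mode_End(1)[OF ab(1)] w] by (metis add_0)
    ultimately have "md V b (- 1) w \<in> gr V p" using gr_add gr_minus w by metis
    moreover have "md V b (- 1) w \<in> gr V (p + 1)"
      using End_part_gr[OF mode_End(1)[OF ab(2)] w] by (metis add.commute)
    ultimately show ?thesis by (rule gr_Int)
  qed
  have "md V b (- 1) (a + b) = md V b (- 1) a + md V b (- 1) b"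
    using mode_End(1)[OF ab(2), of "- 1"] unfolding End_part_def by blast
  then have "b = 0" using hom ab creation(5)[of b] by auto
  then show ?thesis using ab by simp
qed

lemma Dp_odd: "Dp V \<in> End_part L V 1"
proof -
  have "Dp V v \<in> gr V (1 + q)" if "v \<in> gr V q" for v q
    unfolding Dp_def using End_part_gr[OF mode_End(2)[OF that] vac_even]
    by (metis add.commute add_0)
  then show ?thesis
    unfolding End_part_def Dp_def using mode_add(2) mode_act(2) by (auto simp only: mem_Collect_eq mult_1)
qed

lemma Dm_odd: "Dm V \<in> End_part L V 1"
proof -
  have "Dm V v \<in> gr V (1 + q)" if "v \<in> gr V q" for v q
    unfolding Dm_def using End_part_gr[OF mode_End(3)[OF that] vac_even]
    by (metis add.commute add_0)
  then show ?thesis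
    unfolding End_part_def Dm_def using mode_add(3) mode_act(3) by (auto simp only: mem_Collect_eq mult_1)
qed

end

end

theory Submission
  imports Defs
begin

text \<open>
  Write \<open>P(x,\<phi>)w = Y(w,(x,\<phi>\<^sup>+,\<phi>\<^sup>-))\<one>\<close>.  In the Jacobi identity for \<open>v, u\<close> on \<open>\<one>\<close>, put \<open>\<phi>\<^sub>1\<^sup>\<plusminus> = 0\<close>, which makes
  the nilpotent shift \<open>\<nu> = \<phi>\<^sub>1\<^sup>+\<phi>\<^sub>2\<^sup>- + \<phi>\<^sub>1\<^sup>-\<phi>\<^sub>2\<^sup>+\<close> vanish, and take the coefficient of \<open>x\<^sub>1\<^sup>0 x\<^sub>2\<^sup>-\<^sup>1\<close>.  By the
  creation property, what remains is skew supersymmetry with \<open>P(x,\<phi>)\<close> in place of the exponential.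
  The Jacobi identity for \<open>u, \<one>\<close> on \<open>\<one>\<close> gives the composition law
  \<open>P(x\<^sub>2,\<phi>\<^sub>2) P(x\<^sub>0,\<phi>\<^sub>1 - \<phi>\<^sub>2) = P(x\<^sub>0 + x\<^sub>2 + \<nu>,\<phi>\<^sub>1)\<close>.  Its coefficients determine \<open>P\<close> from \<open>\<D>\<^sup>\<plusminus>\<close> and
  show that \<open>n!\<close> times the part of degree \<open>n\<close> of \<open>P\<close> is the \<open>n\<close>-th power of \<open>x\<D> + \<phi>\<^sup>+\<D>\<^sup>+ + \<phi>\<^sup>-\<D>\<^sup>-\<close>; the
  \<open>\<phi>\<^sub>1\<^sup>+\<phi>\<^sub>2\<^sup>-\<close> coefficient, where \<open>\<nu>\<close> contributes, identifies the coefficient of \<open>x\<close> with \<open>\<D>\<close>.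
\<close>

section \<open>Sums with finite support\<close>

lemma Sum_any_single:
  fixes f :: "'a \<Rightarrow> 'b::comm_monoid_add"
  assumes "\<And>a. a \<noteq> b \<Longrightarrow> f a = 0"
  shows "Sum_any f = f b"
proof -
  have "Sum_any f = sum f {b}"
    by (rule Sum_any.expand_superset) (use assms in auto)
  then show ?thesis by simp
qed

text \<open>\<open>g\<close> restricts to a bijection between the supports, so the two sides agree
  also when the support is infinite and both take the default value 0.\<close>

lemma Sum_any_reindex_inj:
  fixes f :: "'a \<Rightarrow> 'b::comm_monoid_add"
  assumes "inj g" and "\<And>a. a \<notin> range g \<Longrightarrow> f a = 0"
  shows "Sum_any f = Sum_any (\<lambda>b. f (g b))"
proof -
  have "bij_betw g {b. f (g b) \<noteq> 0} {a. f a \<noteq> 0}"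
    using assms unfolding bij_betw_def by (auto simp: inj_on_def) (metis (mono_tags, lifting) image_eqI mem_Collect_eq rangeE)
  then show ?thesis
    unfolding Sum_any.expand_set by (simp add: sum.reindex_bij_betw)
qed

section \<open>Coefficients in Grassmann algebras\<close>

lemma gcoeff_add: "gcoeff (a + b) I = gcoeff a I + gcoeff b I"
  by transfer simp

lemma gcoeff_diff: "gcoeff (a - b) I = gcoeff a I - gcoeff b I"
  by transfer simp

lemma gcoeff_uminus: "gcoeff (- a) I = - gcoeff a I"
  by transfer simp

lemma gcoeff_zero: "gcoeff 0 I = 0"
  by transfer simp

lemma gcoeff_one: "gcoeff 1 I = (if I = {} then 1 else 0)"
  by transfer simp

lemma gcoeff_gen: "gcoeff (gen i) I = (if I = {i} then 1 else 0)"
  by transfer simp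

lemma gcoeff_gconst_mult:
  fixes g :: "('o::linorder) grassmann"
  shows "gcoeff (gconst c * g) I = c * gcoeff g I"
proof (transfer, goal_cases)
  case (1 c g I)
  show ?case
  proof (cases "finite I")
    case True
    have "(\<Sum>J\<in>Pow I. gsign J (I - J) * (if J = {} then c else 0) * g (I - J)) =
        (\<Sum>J\<in>Pow I. if J = {} then c * g I else 0)"
      by (rule sum.cong) auto
    then show ?thesis using True by simp
  next
    \<comment> \<open>For infinite \<open>I\<close> the sum over \<open>Pow I\<close> defaults to 0,
      and so does the coefficient of \<open>g\<close>, by the invariant of the type.\<close>
    case False
    then show ?thesis using 1 by auto
  qed
qed

lemma grassmann_eqI: "(\<And>I. gcoeff a I = gcoeff b I) \<Longrightarrow> a = b"
  using gcoeff_inject by blast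

lemma gconst_add: "gconst (c + d) = (gconst c + gconst d :: ('o::linorder) grassmann)"
  by transfer auto

lemma gconst_mult: "gconst (c * d) = (gconst c * gconst d :: ('o::linorder) grassmann)"
  by (rule grassmann_eqI) (simp add: gcoeff_gconst_mult gconst.rep_eq)

lemma gconst_zero: "gconst 0 = (0 :: ('o::linorder) grassmann)"
  by transfer auto

lemma gconst_one: "gconst 1 = (1 :: ('o::linorder) grassmann)"
  by transfer auto

lemma gconst_in_Lambda: "gconst c \<in> Lambda L"
  by (auto simp: Lambda_def gconst.rep_eq split: if_splits)

lemma gconst_in_Lambda_part: "gconst c \<in> Lambda_part L 0"
  by (auto simp: Lambda_part_def gconst_in_Lambda gconst.rep_eq split: if_splits)

lemma gcoeff_mult:
  "gcoeff (a * b) K = (\<Sum>I\<in>Pow K. gsign I (K - I) * gcoeff a I * gcoeff b (K - I))"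
  by transfer simp

lemma gcoeff_mult_eq_0:
  assumes "\<And>I. I \<subseteq> K \<Longrightarrow> gcoeff a I = 0"
  shows "gcoeff (a * b) K = 0"
  unfolding gcoeff_mult by (rule sum.neutral) (use assms in auto)

lemma gsign_singletons: "gsign {i} {j} = (if j < i then - 1 else 1)"
proof -
  have "{(a, b). a \<in> {i} \<and> b \<in> {j} \<and> b < a} = (if j < i then {(i, j)} else {})" by auto
  then show ?thesis unfolding gsign_def by simp
qed

lemma gcoeff_gen_gen:
  "gcoeff (gen i * gen j) K = (if i \<noteq> j \<and> K = {i, j} then if j < i then - 1 else 1 else 0)"
proof (cases "finite K \<and> i \<in> K")
  case True
  have "gcoeff (gen i * gen j) K =
      (\<Sum>I\<in>Pow K. if I = {i} then gsign {i} (K - {i}) * gcoeff (gen j) (K - {i}) else 0)"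
    unfolding gcoeff_mult by (rule sum.cong) (auto simp: gcoeff_gen)
  also have "\<dots> = gsign {i} (K - {i}) * gcoeff (gen j) (K - {i})"
    using True by simp
  also have "\<dots> = (if i \<noteq> j \<and> K = {i, j} then if j < i then - 1 else 1 else 0)"
  proof (cases "K - {i} = {j}")
    case t: True
    then have "i \<noteq> j \<and> K = {i, j}" using True by auto
    with t show ?thesis by (simp add: gcoeff_gen gsign_singletons)
  next
    case False
    then show ?thesis using True by (auto simp: gcoeff_gen)
  qed
  finally show ?thesis .
next
  case False
  then have "gcoeff (gen i * gen j) K = 0"
    unfolding gcoeff_mult
    by (cases "finite K") (auto simp: gcoeff_gen intro!: sum.neutral)
  then show ?thesis using False by auto
qed

lemma ovar_less_simps [simp]: "(a < b) = (ovar_index a < ovar_index b)" for a b :: ovar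
  by (simp add: less_ovar_def)

section \<open>The nilpotent shift and its powers\<close>

lemma gcoeff_nu12:
  "gcoeff nu12 K = (if K = {Phi1_p, Phi2_m} \<or> K = {Phi1_m, Phi2_p} then 1 else 0)"
proof -
  have "{Phi1_p, Phi2_m} \<noteq> {Phi1_m, Phi2_p}" by auto
  then show ?thesis by (auto simp: nu12_def gcoeff_add gcoeff_gen_gen)
qed

text \<open>Both monomials of \<open>nu12\<close> contain one variable with index 1 and one with
  index 2. For such \<open>K\<close>, positive powers of \<open>nu12\<close> have no coefficient at
  any subset of \<open>K\<close>, so at \<open>K\<close> the delta functions lose their
  shift.\<close>

definition nu_free :: "ovar set \<Rightarrow> bool" where
  "nu_free K \<longleftrightarrow> K \<inter> {Phi1_p, Phi1_m} = {} \<or> K \<inter> {Phi2_p, Phi2_m} = {}"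

lemma nu_free_mono: "nu_free K \<Longrightarrow> I \<subseteq> K \<Longrightarrow> nu_free I"
  unfolding nu_free_def by auto

lemma gcoeff_nu12_power_nu_free:
  assumes "nu_free K" "k > 0" "\<nu> \<in> {nu12, - nu12}"
  shows "gcoeff (\<nu> ^ k) K = 0"
proof -
  obtain k' where k: "k = Suc k'" using assms(2) gr0_conv_Suc by auto
  have "gcoeff \<nu> I = 0" if "I \<subseteq> K" for I
    using nu_free_mono[OF assms(1) that] assms(3)
    by (auto simp: nu_free_def gcoeff_uminus gcoeff_nu12)
  then show ?thesis unfolding k power_Suc by (rule gcoeff_mult_eq_0)
qed

text \<open>Each factor \<open>nu12\<close> uses up a variable with index 1, a different one each
  time, while \<open>I\<close> offers only \<open>Phi1_p\<close>.\<close>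

lemma gcoeff_nu12_power_ge_2:
  assumes "k \<ge> 2" "I \<subseteq> {Phi1_p, Phi2_m}"
  shows "gcoeff ((- nu12) ^ k) I = 0"
proof -
  obtain k' where k: "k = Suc (Suc k')" using assms(1)
    by (metis add_2_eq_Suc le_iff_add)
  have "gcoeff (nu12 * nu12) J = 0" if "J \<subseteq> I" for J
  proof -
    have J: "gcoeff nu12 M * gcoeff nu12 (J - M) = 0" if "M \<subseteq> J" for M
    proof (rule ccontr)
      assume "gcoeff nu12 M * gcoeff nu12 (J - M) \<noteq> 0"
      then have "Phi1_p \<in> M \<or> Phi1_m \<in> M" "Phi1_p \<in> J - M \<or> Phi1_m \<in> J - M"
        by (auto simp: gcoeff_nu12 split: if_splits)
      with that \<open>J \<subseteq> I\<close> assms(2) show False by auto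
    qed
    show ?thesis unfolding gcoeff_mult by (rule sum.neutral) (use J in \<open>auto simp: mult.assoc\<close>)
  qed
  then have "gcoeff (nu12 * nu12 * (- nu12) ^ k') I = 0" by (rule gcoeff_mult_eq_0)
  then show ?thesis by (simp add: k mult.assoc)
qed

section \<open>Expansions of delta functions\<close>

lemma bin_pow_eq_0:
  assumes "\<And>j. e \<noteq> Poly_Mapping.single x (m - int j) + Poly_Mapping.single y (int j)"
  shows "bin_pow x t y m e = 0"
  using assms by (simp add: bin_pow_def)

lemma bin_pow_monomial:
  assumes "x \<noteq> y"
  shows "bin_pow x t y m (Poly_Mapping.single x (m - int j) + Poly_Mapping.single y (int j)) =
    (of_int m gchoose j) * t ^ j"
proof -
  have "Poly_Mapping.single x (m - int j) + Poly_Mapping.single y (int j) \<noteq>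
      Poly_Mapping.single x (m - int i) + Poly_Mapping.single y (int i)" if "i \<noteq> j" for i
  proof
    assume "Poly_Mapping.single x (m - int j) + Poly_Mapping.single y (int j) =
      Poly_Mapping.single x (m - int i) + Poly_Mapping.single y (int i)"
    from arg_cong[OF this, of "\<lambda>e. Poly_Mapping.lookup e y"] that assms show False
      by (simp add: lookup_add lookup_single)
  qed
  then show ?thesis unfolding bin_pow_def by (subst Sum_any_single[of j]) auto
qed

text \<open>Exponent of the term of \<open>delta_ser z r x t y\<close> coming from the
  \<open>n\<close>-th power in the delta function, the \<open>k\<close>-th Taylor term of the shift
  and the \<open>j\<close>-th binomial term in \<open>y\<close>.\<close>

definition delta_exp :: "evar \<Rightarrow> evar \<Rightarrow> evar \<Rightarrow> int \<times> nat \<times> nat \<Rightarrow> evexp" where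
  "delta_exp z x y = (\<lambda>(n, k, j). Poly_Mapping.single z (- n - 1) +
     (Poly_Mapping.single x (n - int k - int j) + Poly_Mapping.single y (int j)))"

text \<open>\<open>y\<close> recovers \<open>j\<close>, \<open>z\<close> recovers \<open>n\<close>,
  and then \<open>x\<close> recovers \<open>k\<close>. Hence each coefficient of the delta function
  is a single term rather than a sum.\<close>

lemma inj_delta_exp:
  assumes "x \<noteq> y" "x \<noteq> z" "y \<noteq> z"
  shows "inj (delta_exp z x y)"
proof (rule injI)
  fix a b :: "int \<times> nat \<times> nat"
  assume ab: "delta_exp z x y a = delta_exp z x y b"
  obtain n k j n' k' j' where a: "a = (n, k, j)" and b: "b = (n', k', j')"
    by (metis prod_cases3)
  from ab have eq: "Poly_Mapping.lookup (delta_exp z x y (n, k, j)) w = Poly_Mapping.lookup (delta_exp z x y (n', k', j')) w" for w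
    by (simp add: a b)
  show "a = b"
    unfolding a b using eq[of x] eq[of y] eq[of z] assms by (simp add: delta_exp_def lookup_add lookup_single)
qed

lemma shift_pow_eq_0:
  assumes "\<And>k j. e \<noteq> Poly_Mapping.single x (n - int k - int j) + Poly_Mapping.single y (int j)"
  shows "shift_pow x t y \<nu> n e = 0"
  using assms by (simp add: shift_pow_def bin_pow_eq_0 gconst_zero)

lemma shift_pow_monomial:
  assumes "x \<noteq> y"
  shows "shift_pow x t y \<nu> n
      (Poly_Mapping.single x (n - int k - int j) + Poly_Mapping.single y (int j)) =
    gconst ((of_int n gchoose k) * ((of_int (n - int k) gchoose j) * t ^ j)) * \<nu> ^ k"
proof -
  let ?e = "Poly_Mapping.single x (n - int k - int j) + Poly_Mapping.single y (int j)"
  have "bin_pow x t y (n - int i) ?e = 0" if "i \<noteq> k" for i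
  proof (rule bin_pow_eq_0, rule notI)
    fix l
    assume eq: "?e = Poly_Mapping.single x (n - int i - int l) + Poly_Mapping.single y (int l)"
    show False using arg_cong[OF eq, of "\<lambda>e. Poly_Mapping.lookup e y"] arg_cong[OF eq, of "\<lambda>e. Poly_Mapping.lookup e x"] that assms
      by (simp add: lookup_add lookup_single)
  qed
  then show ?thesis unfolding shift_pow_def
    by (subst Sum_any_single[of k]) (auto simp: gconst_zero bin_pow_monomial[OF assms])
qed

lemma delta_ser_eq_0:
  assumes "e \<notin> range (delta_exp z x y)"
  shows "delta_ser z r x t y \<nu> e = 0"
proof -
  have "shift_pow x t y \<nu> n (e - Poly_Mapping.single z (- n - 1)) = 0" for n
  proof (rule shift_pow_eq_0, rule notI)
    fix k j
    assume "e - Poly_Mapping.single z (- n - 1) =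
      Poly_Mapping.single x (n - int k - int j) + Poly_Mapping.single y (int j)"
    then have "e = delta_exp z x y (n, k, j)"
      by (simp add: delta_exp_def algebra_simps)
    then show False using assms by blast
  qed
  then show ?thesis by (simp add: delta_ser_def)
qed

lemma delta_ser_delta_exp:
  assumes "x \<noteq> y" "x \<noteq> z" "y \<noteq> z"
  shows "delta_ser z r x t y \<nu> (delta_exp z x y (n, k, j)) =
    gconst (r powi (- n) * (of_int n gchoose k) * (of_int (n - int k) gchoose j) * t ^ j) * \<nu> ^ k"
proof -
  have 0: "shift_pow x t y \<nu> i (delta_exp z x y (n, k, j) - Poly_Mapping.single z (- i - 1)) = 0"
    if "i \<noteq> n" for i
  proof (rule shift_pow_eq_0, rule notI)
    fix k' j'
    assume eq: "delta_exp z x y (n, k, j) - Poly_Mapping.single z (- i - 1) =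
      Poly_Mapping.single x (i - int k' - int j') + Poly_Mapping.single y (int j')"
    show False using arg_cong[OF eq, of "\<lambda>e. Poly_Mapping.lookup e z"] assms that
      by (simp add: delta_exp_def lookup_add lookup_minus lookup_single)
  qed
  have 1: "delta_exp z x y (n, k, j) - Poly_Mapping.single z (- n - 1) =
      Poly_Mapping.single x (n - int k - int j) + Poly_Mapping.single y (int j)"
    by (simp add: delta_exp_def)
  show ?thesis unfolding delta_ser_def
    by (subst Sum_any_single[of n])
      (auto simp: 0 1 shift_pow_monomial[OF assms(1)] gconst_mult mult.assoc)
qed

section \<open>Modes as bilinear maps\<close>

context graded_Lambda_module
begin

text \<open>Constants lie in \<open>Lambda L\<close> for every \<open>L\<close>, so \<open>V\<close>
  is a complex vector space under \<open>csc V\<close>.\<close>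

sublocale cvs: vector_space "csc V"
  by unfold_locales
    (simp_all add: csc_def act_add_right act_add_left act_mult act_one gconst_in_Lambda gconst_add
      gconst_mult gconst_one)

text \<open>The Jacobi identity speaks of homogeneous vectors only. Every vector is a sum of an even
  and an odd one, so additive consequences extend to all of \<open>V\<close>.\<close>

lemma additive_gr_eqI:
  assumes add: "\<And>v w. f (v + w) = f v + f w" "\<And>v w. g (v + w) = g v + (g w :: 'b::ab_group_add)"
    and gr: "\<And>p v. v \<in> gr V p \<Longrightarrow> f v = g v"
  shows "f v = g v"
proof -
  obtain a b where "a \<in> gr V 0" "b \<in> gr V 1" "v = a + b"
    using gr_direct_sum[of v] by auto
  then show ?thesis using add gr by metis
qed

section \<open>Multiplication by odd polynomials and by delta functions\<close>

lemma omult_scaled: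
  "omult V (gconst c * g) F e K = csc V c (omult V g F e K)"
  by (simp add: omult_def gcoeff_gconst_mult cvs.scale_sum_right mult.left_commute)

text \<open>Off the range of \<open>delta_exp\<close> the delta function vanishes and on it the
  coefficient is explicit, so the sum over exponents becomes a sum over triples. Comparing exponents
  will later single out the surviving triples.\<close>

lemma ser_mult_delta:
  assumes "x \<noteq> y" "x \<noteq> z" "y \<noteq> z"
  shows "ser_mult V (delta_ser z r x t y \<nu>) F e K = Sum_any (\<lambda>(n, k, j).
    csc V (r powi (- n) * (of_int n gchoose k) * (of_int (n - int k) gchoose j) * t ^ j)
      (omult V (\<nu> ^ k) F (e - delta_exp z x y (n, k, j)) K))"
proof -
  have "ser_mult V (delta_ser z r x t y \<nu>) F e K = Sum_any (\<lambda>a.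
      omult V (delta_ser z r x t y \<nu> (delta_exp z x y a)) F (e - delta_exp z x y a) K)"
    unfolding ser_mult_def
    by (rule Sum_any_reindex_inj[OF inj_delta_exp[OF assms]])
      (simp add: delta_ser_eq_0 omult_def gcoeff_zero)
  also have "\<dots> = Sum_any (\<lambda>(n, k, j).
    csc V (r powi (- n) * (of_int n gchoose k) * (of_int (n - int k) gchoose j) * t ^ j)
      (omult V (\<nu> ^ k) F (e - delta_exp z x y (n, k, j)) K))"
    by (rule arg_cong[of _ _ Sum_any]) (auto simp: delta_ser_delta_exp[OF assms] omult_scaled)
  finally show ?thesis .
qed

lemma omult_eq_0:
  assumes "\<And>I. I \<subseteq> K \<Longrightarrow> F e I = 0"
  shows "omult V g F e K = 0"
  unfolding omult_def by (rule sum.neutral) (use assms in auto)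

lemma omult_eq_0':
  assumes "\<And>I. I \<subseteq> K \<Longrightarrow> gcoeff g I = 0"
  shows "omult V g F e K = 0"
  unfolding omult_def by (rule sum.neutral) (use assms in auto)

lemma omult_one: "omult V 1 F e K = F e K"
proof -
  have "omult V 1 F e K = (\<Sum>I\<in>Pow K. if I = {} then F e K else 0)"
    unfolding omult_def by (rule sum.cong) (auto simp: gcoeff_one)
  then show ?thesis by simp
qed

lemma omult_gmonom:
  "omult V (gmonom I) F e K = (if I \<subseteq> K then csc V (gsign I (K - I)) (F e (K - I)) else 0)"
proof -
  have "omult V (gmonom I) F e K =
      (\<Sum>J\<in>Pow K. if J = I then csc V (gsign I (K - I)) (F e (K - I)) else 0)"
    unfolding omult_def by (rule sum.cong) (auto simp: gmonom.rep_eq)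
  then show ?thesis by simp
qed

lemma omult_only_empty:
  assumes "\<And>J. J \<subseteq> K \<Longrightarrow> J \<noteq> {} \<Longrightarrow> F e J = 0"
  shows "omult V g F e K = csc V (gcoeff g K) (F e {})"
proof -
  have "omult V g F e K =
      (\<Sum>I\<in>Pow K. if I = K then csc V (gcoeff g K) (F e {}) else 0)"
    unfolding omult_def
  proof (rule sum.cong)
    fix I assume "I \<in> Pow K"
    then have "K - I = {} \<longleftrightarrow> I = K" by auto
    then show "csc V (gsign I (K - I) * gcoeff g I) (F e (K - I)) =
        (if I = K then csc V (gcoeff g K) (F e {}) else 0)"
      using assms[of "K - I"] by auto
  qed simp
  then show ?thesis by simp
qed

end

context N2_vertex_superalgebra
begin

text \<open>Constants are even, so the sign in \<open>mode_act\<close> is 1.\<close>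

lemma mode_csc_left:
  "md V (csc V c v) n z = csc V c (md V v n z)"
  "mdp V (csc V c v) n z = csc V c (mdp V v n z)"
  "mdm V (csc V c v) n z = csc V c (mdm V v n z)"
  "mdpm V (csc V c v) n z = csc V c (mdpm V v n z)"
  using mode_act[OF gconst_in_Lambda_part, of c v n z] by (simp_all add: csc_def[of V c] psign_def)

lemma End_part_csc: "f \<in> End_part L V p \<Longrightarrow> f (csc V c z) = csc V c (f z)"
  using gconst_in_Lambda_part[of c L] unfolding End_part_def csc_def[of V c]
  by (fastforce simp: psign_def)

lemma mode_csc_right:
  "md V v n (csc V c z) = csc V c (md V v n z)"
  "mdp V v n (csc V c z) = csc V c (mdp V v n z)"
  "mdm V v n (csc V c z) = csc V c (mdm V v n z)"
  "mdpm V v n (csc V c z) = csc V c (mdpm V v n z)"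
proof -
  \<comment> \<open>Membership in \<open>End_part\<close> is given for homogeneous \<open>v\<close>;
    additivity in \<open>v\<close> does the rest.\<close>
  show "md V v n (csc V c z) = csc V c (md V v n z)"
    by (rule additive_gr_eqI[of "\<lambda>v. md V v n (csc V c z)"])
      (use End_part_csc[OF mode_End(1)] in \<open>auto simp: mode_add cvs.scale_right_distrib\<close>)
  show "mdp V v n (csc V c z) = csc V c (mdp V v n z)"
    by (rule additive_gr_eqI[of "\<lambda>v. mdp V v n (csc V c z)"])
      (use End_part_csc[OF mode_End(2)] in \<open>auto simp: mode_add cvs.scale_right_distrib\<close>)
  show "mdm V v n (csc V c z) = csc V c (mdm V v n z)"
    by (rule additive_gr_eqI[of "\<lambda>v. mdm V v n (csc V c z)"])
      (use End_part_csc[OF mode_End(3)] in \<open>auto simp: mode_add cvs.scale_right_distrib\<close>)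
  show "mdpm V v n (csc V c z) = csc V c (mdpm V v n z)"
    by (rule additive_gr_eqI[of "\<lambda>v. mdpm V v n (csc V c z)"])
      (use End_part_csc[OF mode_End(4)] in \<open>auto simp: mode_add cvs.scale_right_distrib\<close>)
qed

lemma mode_zero [simp]:
  "md V v n 0 = 0" "mdp V v n 0 = 0" "mdm V v n 0 = 0" "mdpm V v n 0 = 0"
  "md V 0 n z = 0" "mdp V 0 n z = 0" "mdm V 0 n z = 0" "mdpm V 0 n z = 0"
  using mode_csc_right[of v n 0 0] mode_csc_left[of 0 0 n z] by simp_all

lemma mode_minus_left:
  "md V (- v) n z = - md V v n z"
  "mdp V (- v) n z = - mdp V v n z"
  "mdm V (- v) n z = - mdm V v n z"
  "mdpm V (- v) n z = - mdpm V v n z"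
  using mode_csc_left[of "- 1" v n z] by simp_all

section \<open>Coefficients of vertex operators\<close>

text \<open>The coefficient of \<open>x^(-n-1) phi_K\<close> in
  \<open>Y(v,(x,theta+,theta-))w\<close>. As \<open>w\<close> carries no odd variables, odd modes
  reach it without a sign.\<close>

definition vcoef :: "'v \<Rightarrow> ovar grassmann \<Rightarrow> ovar grassmann \<Rightarrow> int \<Rightarrow> 'v \<Rightarrow> ovar set \<Rightarrow> 'v" where
  "vcoef v \<theta>p \<theta>m n w K = (if K = {} then md V v n w else 0) + csc V (gcoeff \<theta>p K) (mdp V v n w) +
     csc V (gcoeff \<theta>m K) (mdm V v n w) + csc V (gcoeff (\<theta>p * \<theta>m) K) (mdpm V v n w)"

lemma vcoef_zero_left [simp]: "vcoef 0 \<theta>p \<theta>m n w K = 0"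
  by (simp add: vcoef_def)

text \<open>A vertex operator in \<open>x\<close> shifts only the exponent of \<open>x\<close> and
  multiplies by odd variables, so its entry at \<open>(e, K)\<close> sees only these entries of
  \<open>F\<close>.\<close>

lemma vop_cong:
  assumes "\<And>n I. I \<subseteq> K \<Longrightarrow>
    F (e - Poly_Mapping.single x n) I = G (e - Poly_Mapping.single x n) I"
  shows "vop V p v c x \<theta>p \<theta>m F e K = vop V p v c x \<theta>p \<theta>m G e K"
proof -
  have "omult V \<theta> (End_ser V q f F) (e - Poly_Mapping.single x n) K =
      omult V \<theta> (End_ser V q f G) (e - Poly_Mapping.single x n) K" for \<theta> q f n
    unfolding omult_def End_ser_def by (rule sum.cong) (use assms in auto)
  moreover have "End_ser V q f F (e - Poly_Mapping.single x n) K =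
      End_ser V q f G (e - Poly_Mapping.single x n) K" for q f n
    unfolding End_ser_def using assms[of K] by simp
  ultimately show ?thesis
    unfolding vop_def csc_ser_def xmult_def by (simp only:)
qed

lemma vop_zero: "vop V p v c x \<theta>p \<theta>m (\<lambda>e K. 0) e K = 0"
  by (simp add: vop_def csc_ser_def xmult_def End_ser_def omult_def)

lemma vop_eq_0:
  assumes "\<And>n I. I \<subseteq> K \<Longrightarrow> F (e - Poly_Mapping.single x n) I = 0"
  shows "vop V p v c x \<theta>p \<theta>m F e K = 0"
  using vop_cong[of K F e x "\<lambda>e K. 0"] assms vop_zero by simp

lemma vop_vac: "vop V 0 (vac V) 1 x \<theta>p \<theta>m F = F"
proof (rule ext, rule ext)
  fix e K
  have "vop V 0 (vac V) 1 x \<theta>p \<theta>m F e K = Sum_any (\<lambda>n::int. if n = - 1 then F e K else 0)"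
    unfolding vop_def
    by (rule arg_cong[of _ _ Sum_any], rule ext)
      (simp add: csc_ser_def xmult_def End_ser_def vacuum psign_def omult_def)
  then show "vop V 0 (vac V) 1 x \<theta>p \<theta>m F e K = F e K"
    by (simp add: Sum_any_single[of "- 1"])
qed

lemma vop_const_ser:
  "vop V p v c x \<theta>p \<theta>m (const_ser w) e K =
    (if e = Poly_Mapping.single x (Poly_Mapping.lookup e x)
     then csc V (c powi Poly_Mapping.lookup e x)
       (vcoef v \<theta>p \<theta>m (- Poly_Mapping.lookup e x - 1) w K)
     else 0)"
proof -
  define t where "t n = csc_ser V (c powi (- n - 1)) (xmult x (- n - 1) (\<lambda>e K.
         End_ser V p (md V v n) (const_ser w) e K
       + omult V \<theta>p (End_ser V (p + 1) (mdp V v n) (const_ser w)) e K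
       + omult V \<theta>m (End_ser V (p + 1) (mdm V v n) (const_ser w)) e K
       + omult V (\<theta>p * \<theta>m) (End_ser V p (mdpm V v n) (const_ser w)) e K)) e K" for n
  \<comment> \<open>\<open>const_ser w\<close> lives at exponent 0, so mode \<open>n\<close>
    contributes only to \<open>x^(-n-1)\<close>.\<close>
  have 0: "t n = 0" if "e \<noteq> Poly_Mapping.single x (- n - 1)" for n
  proof -
    have "e - Poly_Mapping.single x (- n - 1) \<noteq> 0" using that by simp
    then show ?thesis
      by (simp add: t_def csc_ser_def xmult_def End_ser_def const_ser_def omult_def)
  qed
  have om: "omult V \<theta> (End_ser V q f (const_ser w)) 0 K = csc V (gcoeff \<theta> K) (f w)"
    and const: "End_ser V q f (const_ser w) 0 K = (if K = {} then f w else 0)"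
    if "f 0 = 0" for \<theta> q f
  proof -
    show "omult V \<theta> (End_ser V q f (const_ser w)) 0 K = csc V (gcoeff \<theta> K) (f w)"
    by (subst omult_only_empty) (use that in \<open>auto simp: End_ser_def const_ser_def psign_def\<close>)
    show "End_ser V q f (const_ser w) 0 K = (if K = {} then f w else 0)"
      using that by (simp add: End_ser_def const_ser_def psign_def)
  qed
  have 1: "t n = csc V (c powi (- n - 1)) (vcoef v \<theta>p \<theta>m n w K)"
    if "e = Poly_Mapping.single x (- n - 1)" for n
    using that by (simp add: t_def csc_ser_def xmult_def om const vcoef_def)
  have sum: "vop V p v c x \<theta>p \<theta>m (const_ser w) e K = Sum_any t"
    unfolding vop_def t_def ..
  show ?thesis
  proof (cases "e = Poly_Mapping.single x (Poly_Mapping.lookup e x)")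
    case True
    let ?n = "- Poly_Mapping.lookup e x - 1"
    have "t n = 0" if "n \<noteq> ?n" for n
    proof (rule 0, rule notI)
      assume "e = Poly_Mapping.single x (- n - 1)"
      then have "Poly_Mapping.lookup e x = - n - 1" by simp
      then show False using that by simp
    qed
    then have "Sum_any t = t ?n" by (rule Sum_any_single)
    then show ?thesis using True 1[of ?n] sum by simp
  next
    case False
    then have "t n = 0" for n by (intro 0) auto
    then show ?thesis using False sum by simp
  qed
qed

text \<open>\<open>A\<close> involves only the even variable \<open>y\<close> and the outer operator
  only \<open>x\<close>, so \<open>e\<close> splits uniquely between them. What remains is a sum
  over the ways to distribute \<open>K\<close>.\<close>

lemma vop_ser_const_ser:
  assumes A: "\<And>e I. A e I =
      (if e = Poly_Mapping.single y (Poly_Mapping.lookup e y) then f (Poly_Mapping.lookup e y) I else 0)"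
    and xy: "x \<noteq> y"
  shows "vop_ser V p A 1 x \<theta>p \<theta>m (const_ser w) e K =
    (if e = Poly_Mapping.single y (Poly_Mapping.lookup e y) +
        Poly_Mapping.single x (Poly_Mapping.lookup e x)
     then \<Sum>I\<in>Pow K. csc V (gsign I (K - I))
       (vcoef (f (Poly_Mapping.lookup e y) I) \<theta>p \<theta>m (- Poly_Mapping.lookup e x - 1) w (K - I))
     else 0)"
proof -
  define t where "t = (\<lambda>(e', I).
     omult V (gmonom I) (vop V (p + of_nat (card I)) (A e' I) 1 x \<theta>p \<theta>m (const_ser w)) (e - e') K)"
  define e0 where "e0 = Poly_Mapping.single y (Poly_Mapping.lookup e y)"
  have sum: "vop_ser V p A 1 x \<theta>p \<theta>m (const_ser w) e K = Sum_any t"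
    unfolding vop_ser_def t_def ..
  have t: "t (e', I) = (if I \<subseteq> K \<and> e' = Poly_Mapping.single y (Poly_Mapping.lookup e' y)
       \<and> e - e' = Poly_Mapping.single x (Poly_Mapping.lookup (e - e') x)
     then csc V (gsign I (K - I)) (vcoef (f (Poly_Mapping.lookup e' y) I) \<theta>p \<theta>m
       (- Poly_Mapping.lookup (e - e') x - 1) w (K - I)) else 0)" for e' I
    unfolding t_def by (subst A) (simp add: omult_gmonom vop_const_ser)
  have imp: "e' = e0 \<and> e = e0 + Poly_Mapping.single x (Poly_Mapping.lookup e x)"
    if e': "e' = Poly_Mapping.single y (Poly_Mapping.lookup e' y)"
      "e - e' = Poly_Mapping.single x (Poly_Mapping.lookup (e - e') x)" for e'
  proof -
    have "Poly_Mapping.lookup e y = Poly_Mapping.lookup e' y"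
      using arg_cong[OF e'(2), of "\<lambda>e. Poly_Mapping.lookup e y"] xy
      by (simp add: lookup_minus lookup_single)
    then have 1: "e' = e0" unfolding e0_def using e'(1) by simp
    have "Poly_Mapping.lookup (e - e') x = Poly_Mapping.lookup e x"
      using xy by (simp add: 1 e0_def lookup_minus lookup_single)
    then show ?thesis using e'(2) 1 by (simp add: algebra_simps)
  qed
  show ?thesis
  proof (cases "e = e0 + Poly_Mapping.single x (Poly_Mapping.lookup e x)")
    case True
    have x: "Poly_Mapping.lookup (e - e0) x = Poly_Mapping.lookup e x"
      using xy by (simp add: e0_def lookup_minus lookup_single)
    have "Sum_any t = sum t (Pair e0 ` Pow K)"
      by (rule Sum_any.expand_superset) (use imp in \<open>auto simp: t split: if_splits\<close>)
    also have "\<dots> = (\<Sum>I\<in>Pow K. t (e0, I))"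
      by (subst sum.reindex) (auto simp: inj_on_def)
    also have "\<dots> = (\<Sum>I\<in>Pow K. csc V (gsign I (K - I))
       (vcoef (f (Poly_Mapping.lookup e y) I) \<theta>p \<theta>m (- Poly_Mapping.lookup e x - 1) w (K - I)))"
    proof (rule sum.cong)
      fix I assume "I \<in> Pow K"
      moreover have "e - e0 = Poly_Mapping.single x (Poly_Mapping.lookup (e - e0) x)"
        unfolding x by (subst True) simp
      moreover have "Poly_Mapping.lookup e0 y = Poly_Mapping.lookup e y" by (simp add: e0_def)
      ultimately show "t (e0, I) = csc V (gsign I (K - I))
       (vcoef (f (Poly_Mapping.lookup e y) I) \<theta>p \<theta>m (- Poly_Mapping.lookup e x - 1) w (K - I))"
        unfolding t x by (simp add: e0_def)
    qed simp
    finally show ?thesis using True sum by (simp add: e0_def)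
  next
    case False
    then have "t a = 0" for a using imp by (cases a) (auto simp: t)
    then show ?thesis using False sum by (simp add: e0_def)
  qed
qed

section \<open>Consequences of the Jacobi identity on the vacuum\<close>

lemma vcoef_creation: "n \<ge> 0 \<Longrightarrow> vcoef v \<theta>p \<theta>m n (vac V) K = 0"
  by (simp add: vcoef_def creation)

lemma vop_const_vac_eq_0:
  "Poly_Mapping.lookup e x < 0 \<Longrightarrow> vop V p v c x \<theta>p \<theta>m (const_ser (vac V)) e K = 0"
  by (simp add: vop_const_ser vcoef_creation)

text \<open>The coefficient of \<open>x_0^(-n-1) x_2^(-m-1) phi_K\<close> in the iterate
  \<open>Y(Y(u,(x_0,phi_1-phi_2))v,(x_2,phi_2))w\<close> of the Jacobi identity.\<close>

definition iterate_coef :: "'v \<Rightarrow> 'v \<Rightarrow> int \<Rightarrow> int \<Rightarrow> 'v \<Rightarrow> ovar set \<Rightarrow> 'v" where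
  "iterate_coef u v n m w K = (\<Sum>I\<in>Pow K. csc V (gsign I (K - I))
     (vcoef (vcoef u (gen Phi1_p - gen Phi2_p) (gen Phi1_m - gen Phi2_m) n v I)
       (gen Phi2_p) (gen Phi2_m) m w (K - I)))"

lemma vop_ser_iterate:
  "vop_ser V p (vop V j u 1 Var_x0 (gen Phi1_p - gen Phi2_p) (gen Phi1_m - gen Phi2_m) (const_ser v))
      1 Var_x2 (gen Phi2_p) (gen Phi2_m) (const_ser w) e K =
    (if e = Poly_Mapping.single Var_x0 (Poly_Mapping.lookup e Var_x0) +
        Poly_Mapping.single Var_x2 (Poly_Mapping.lookup e Var_x2)
     then iterate_coef u v (- Poly_Mapping.lookup e Var_x0 - 1) (- Poly_Mapping.lookup e Var_x2 - 1) w K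
     else 0)"
  unfolding iterate_coef_def
  by (rule vop_ser_const_ser[where f = "\<lambda>m. vcoef u (gen Phi1_p - gen Phi2_p)
      (gen Phi1_m - gen Phi2_m) (- m - 1) v"]) (simp_all add: vop_const_ser)

text \<open>
  The coefficient of \<open>x\<^sub>0\<^sup>a x\<^sub>1\<^sup>0 x\<^sub>2\<^sup>-\<^sup>1\<close> at \<open>\<phi>\<^sub>1\<^sup>\<plusminus> = 0\<close>: the creation property kills the first term
  on the left and reduces the second one to \<open>Y(v,(x\<^sub>2,\<phi>\<^sub>2\<^sup>+,\<phi>\<^sub>2\<^sup>-))u\<close>.
\<close>

lemma iterate_sum_eq_vcoef:
  assumes u: "u \<in> gr V j" and v: "v \<in> gr V k" and K: "K \<subseteq> {Phi2_p, Phi2_m}"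
  shows "Sum_any (\<lambda>i::nat. csc V ((- 1) ^ i) (iterate_coef u v (int i - a - 1) (- int i - 1) (vac V) K)) =
    csc V (psign (j * k) * (- 1) powi a) (vcoef v (gen Phi2_p) (gen Phi2_m) (- a - 1) u K)"
proof -
  let ?e = "Poly_Mapping.single Var_x0 a + Poly_Mapping.single Var_x2 (- 1)"
  let ?Yu = "vop V j u 1 Var_x1 (gen Phi1_p) (gen Phi1_m)"
  let ?Yv = "vop V k v 1 Var_x2 (gen Phi2_p) (gen Phi2_m)"
  let ?H = "vop_ser V (j + k)
      (vop V j u 1 Var_x0 (gen Phi1_p - gen Phi2_p) (gen Phi1_m - gen Phi2_m) (const_ser v))
      1 Var_x2 (gen Phi2_p) (gen Phi2_m) (const_ser (vac V))"
  \<comment> \<open>\<open>K\<close> has no variable with index 1, which removes the shift from all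
    three delta functions.\<close>
  have free: "omult V (\<nu> ^ l) F e K = 0" if "l > 0" "\<nu> \<in> {nu12, - nu12}" for \<nu> l F e
    using K gcoeff_nu12_power_nu_free[OF _ that]
    by (intro omult_eq_0') (auto simp: nu_free_def)
  \<comment> \<open>The delta function contributes \<open>x_2^i\<close> with \<open>i >= 0\<close>,
    so \<open>x_2^(-1-i)\<close> is left for \<open>Y(v)\<close> on the vacuum, which has no
    negative powers.\<close>
  have T1: "ser_mult V (delta_ser Var_x0 1 Var_x1 (- 1) Var_x2 (- nu12))
      (?Yu (?Yv (const_ser (vac V)))) ?e K = 0"
  proof -
    have "omult V g (?Yu (?Yv (const_ser (vac V)))) (?e - delta_exp Var_x0 Var_x1 Var_x2 (n, l, i)) K = 0"
      for g n l i
      by (intro omult_eq_0 vop_eq_0 vop_const_vac_eq_0)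
        (simp add: delta_exp_def lookup_minus lookup_add lookup_single)
    then show ?thesis by (subst ser_mult_delta) (auto intro!: Sum_any.neutral)
  qed
  \<comment> \<open>Creation forces the power \<open>x_1^i\<close> to have \<open>i = 0\<close>, and
    \<open>x_0^a\<close> forces \<open>n = - a - 1\<close>. The factor \<open>(-1)^(a+1)\<close>
    comes from the denominator \<open>-x_0\<close>.\<close>
  have T2: "ser_mult V (delta_ser Var_x0 (- 1) Var_x2 (- 1) Var_x1 nu12)
      (?Yv (?Yu (const_ser (vac V)))) ?e K =
    csc V ((- 1) powi (a + 1)) (vcoef v (gen Phi2_p) (gen Phi2_m) (- a - 1) u K)"
  proof -
    have 0: "omult V (nu12 ^ l) (?Yv (?Yu (const_ser (vac V))))
        (?e - delta_exp Var_x0 Var_x2 Var_x1 (n, l, i)) K = 0"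
      if ne: "(n, l, i) \<noteq> (- a - 1, 0, 0)" for n l i
    proof (cases "l > 0")
      case True
      then show ?thesis by (simp add: free)
    next
      case l: False
      have "?Yu (const_ser (vac V)) (?e - delta_exp Var_x0 Var_x2 Var_x1 (n, l, i) -
          Poly_Mapping.single Var_x2 m) I = 0" for m I
      proof (cases "i > 0")
        case True
        then show ?thesis
          by (intro vop_const_vac_eq_0)
            (simp add: delta_exp_def lookup_minus lookup_add lookup_single)
      next
        case False
        let ?e' = "?e - delta_exp Var_x0 Var_x2 Var_x1 (n, l, i) - Poly_Mapping.single Var_x2 m"
        have "Poly_Mapping.lookup ?e' Var_x0 \<noteq>
            Poly_Mapping.lookup (Poly_Mapping.single Var_x1 (Poly_Mapping.lookup ?e' Var_x1)) Var_x0"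
          using False l ne by (simp add: delta_exp_def lookup_minus lookup_add lookup_single)
        then have "?e' \<noteq> Poly_Mapping.single Var_x1 (Poly_Mapping.lookup ?e' Var_x1)"
          by metis
        then show ?thesis by (simp only: vop_const_ser if_False)
      qed
      then show ?thesis by (intro omult_eq_0, rule vop_eq_0)
    qed
    have e': "?e - delta_exp Var_x0 Var_x2 Var_x1 (- a - 1, 0, 0) = Poly_Mapping.single Var_x2 a"
      by (simp add: delta_exp_def algebra_simps flip: single_add single_diff)
    have "?Yu (const_ser (vac V)) (Poly_Mapping.single Var_x2 a - Poly_Mapping.single Var_x2 n) I =
        const_ser u (Poly_Mapping.single Var_x2 a - Poly_Mapping.single Var_x2 n) I"
      if "I \<subseteq> K" for n I
    proof -
      have "I \<noteq> {Phi1_p}" "I \<noteq> {Phi1_m}" "I \<noteq> {Phi1_p, Phi1_m}" using that K by auto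
      then have "vcoef u (gen Phi1_p) (gen Phi1_m) (- 1) (vac V) I = (if I = {} then u else 0)"
        by (simp add: vcoef_def gcoeff_gen gcoeff_gen_gen creation)
      then show ?thesis
        unfolding vop_const_ser by (auto simp: const_ser_def lookup_minus lookup_single)
    qed
    then have "?Yv (?Yu (const_ser (vac V))) (Poly_Mapping.single Var_x2 a) K =
        ?Yv (const_ser u) (Poly_Mapping.single Var_x2 a) K"
      by (rule vop_cong)
    also have "\<dots> = vcoef v (gen Phi2_p) (gen Phi2_m) (- a - 1) u K"
      by (simp add: vop_const_ser)
    finally have val: "?Yv (?Yu (const_ser (vac V))) (Poly_Mapping.single Var_x2 a) K =
        vcoef v (gen Phi2_p) (gen Phi2_m) (- a - 1) u K" .
    show ?thesis
      apply (subst ser_mult_delta, simp, simp, simp)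
      apply (subst Sum_any_single[of "(- a - 1, 0, 0)"])
      subgoal for b by (cases b, simp only: case_prod_conv, subst 0, simp, simp)
      apply (simp add: e' omult_one val add.commute)
      done
  qed
  \<comment> \<open>The iterate is free of \<open>x_1\<close>, so the total power
    \<open>x_1^0\<close> forces \<open>n = i\<close>; the binomial coefficient is then 1.\<close>
  have T3: "ser_mult V (delta_ser Var_x2 1 Var_x1 (- 1) Var_x0 (- nu12)) ?H ?e K =
    Sum_any (\<lambda>i::nat. csc V ((- 1) ^ i) (iterate_coef u v (int i - a - 1) (- int i - 1) (vac V) K))"
  proof -
    let ?g = "\<lambda>i::nat. (int i, 0 :: nat, i)"
    have inj: "inj ?g" by (auto simp: inj_on_def)
    have 0: "omult V ((- nu12) ^ l) ?H (?e - delta_exp Var_x2 Var_x1 Var_x0 (n, l, i)) K = 0"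
      if ne: "(n, l, i) \<notin> range ?g" for n l i
    proof (cases "l > 0")
      case True
      then show ?thesis by (simp add: free)
    next
      case False
      let ?e' = "?e - delta_exp Var_x2 Var_x1 Var_x0 (n, l, i)"
      have "Poly_Mapping.lookup ?e' Var_x1 \<noteq>
            Poly_Mapping.lookup (Poly_Mapping.single Var_x0 (Poly_Mapping.lookup ?e' Var_x0) +
              Poly_Mapping.single Var_x2 (Poly_Mapping.lookup ?e' Var_x2)) Var_x1"
        using False ne by (simp add: delta_exp_def lookup_minus lookup_add lookup_single image_iff)
      then have "?e' \<noteq> Poly_Mapping.single Var_x0 (Poly_Mapping.lookup ?e' Var_x0) +
              Poly_Mapping.single Var_x2 (Poly_Mapping.lookup ?e' Var_x2)"
        by metis
      then show ?thesis by (intro omult_eq_0) (simp only: vop_ser_iterate if_False)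
    qed
    have e': "?e - delta_exp Var_x2 Var_x1 Var_x0 (int i, 0, i) =
        Poly_Mapping.single Var_x0 (a - int i) + Poly_Mapping.single Var_x2 (int i)" for i
      by (rule poly_mapping_eqI)
        (simp add: delta_exp_def lookup_minus lookup_add lookup_single when_def)
    show ?thesis
      apply (subst ser_mult_delta, simp, simp, simp)
      apply (subst Sum_any_reindex_inj[OF inj])
      subgoal for a by (cases a, simp only: case_prod_conv, subst 0, assumption, simp)
      apply (simp add: e' omult_one vop_ser_iterate lookup_add lookup_single flip: binomial_gbinomial)
      done
  qed
  have "ser_mult V (delta_ser Var_x0 1 Var_x1 (- 1) Var_x2 (- nu12))
      (?Yu (?Yv (const_ser (vac V)))) ?e K - csc V (psign (j * k))
        (ser_mult V (delta_ser Var_x0 (- 1) Var_x2 (- 1) Var_x1 nu12)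
      (?Yv (?Yu (const_ser (vac V)))) ?e K) =
      ser_mult V (delta_ser Var_x2 1 Var_x1 (- 1) Var_x0 (- nu12)) ?H ?e K"
    using fun_cong[OF fun_cong[OF Jacobi[OF u v, of "vac V"], of ?e], of K]
    by (simp add: csc_ser_def)
  then show ?thesis unfolding T1 T2 T3 by (simp add: power_int_add)
qed

section \<open>The composition law for operators on the vacuum\<close>

lemma gchoose_pred_self: "(of_int (int i - 1) gchoose i :: complex) = (if i = 0 then 1 else 0)"
proof (cases i)
  case (Suc l)
  then have "(of_int (int i - 1) :: complex) = of_nat l" by simp
  then show ?thesis using Suc by (simp flip: binomial_gbinomial)
qed simp

text \<open>Upper negation; it turns the expansion of \<open>(x_1-x_2)^(-p-1)\<close> into ordinary
  binomial coefficients.\<close>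

lemma gchoose_neg: "(of_int (- int p - 1) gchoose q) * (- 1) ^ q = (of_nat ((p + q) choose q) :: complex)"
proof -
  have "(of_int (- int p - 1) :: complex) = - of_nat (p + 1)" by simp
  then show ?thesis
    by (simp only: gbinomial_minus) (simp add: binomial_gbinomial flip: power_add)
qed

text \<open>
  The coefficient of \<open>x\<^sub>0\<^sup>p x\<^sub>1\<^sup>-\<^sup>1 x\<^sub>2\<^sup>q\<close> for \<open>v = \<one>\<close>, which says that
  \<open>Y(Y(u,(x\<^sub>0,\<phi>\<^sub>1\<^sup>+-\<phi>\<^sub>2\<^sup>+,\<phi>\<^sub>1\<^sup>--\<phi>\<^sub>2\<^sup>-))\<one>,(x\<^sub>2,\<phi>\<^sub>2\<^sup>+,\<phi>\<^sub>2\<^sup>-))\<one>\<close> is \<open>Y(u,(x\<^sub>0+x\<^sub>2+\<nu>,\<phi>\<^sub>1\<^sup>+,\<phi>\<^sub>1\<^sup>-))\<one>\<close>.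
\<close>

lemma iterate_vac:
  assumes u: "u \<in> gr V j"
  shows "iterate_coef u (vac V) (- int p - 1) (- int q - 1) (vac V) K =
    Sum_any (\<lambda>l::nat. csc V ((of_int (- int p - 1) gchoose l) * (of_int (- int (p + l) - 1) gchoose q) * (- 1) ^ q)
      (omult V ((- nu12) ^ l) (\<lambda>e. vcoef u (gen Phi1_p) (gen Phi1_m) (- int (p + q + l) - 1) (vac V)) 0 K))"
proof -
  let ?e = "Poly_Mapping.single Var_x0 (int p) + (Poly_Mapping.single Var_x1 (- 1) +
      Poly_Mapping.single Var_x2 (int q))"
  let ?Yu = "vop V j u 1 Var_x1 (gen Phi1_p) (gen Phi1_m)"
  let ?Yv = "vop V 0 (vac V) 1 Var_x2 (gen Phi2_p) (gen Phi2_m)"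
  let ?H = "vop_ser V (j + 0)
      (vop V j u 1 Var_x0 (gen Phi1_p - gen Phi2_p) (gen Phi1_m - gen Phi2_m) (const_ser (vac V)))
      1 Var_x2 (gen Phi2_p) (gen Phi2_m) (const_ser (vac V))"
  \<comment> \<open>\<open>Y(1)\<close> is the identity, so the powers of \<open>x_0\<close> and
    \<open>x_2\<close> come from the delta function alone and fix \<open>n = - p - 1\<close> and
    \<open>i = q\<close>; only the Taylor order \<open>l\<close> stays free.\<close>
  have T1: "ser_mult V (delta_ser Var_x0 1 Var_x1 (- 1) Var_x2 (- nu12))
      (?Yu (?Yv (const_ser (vac V)))) ?e K =
    Sum_any (\<lambda>l::nat. csc V ((of_int (- int p - 1) gchoose l) * (of_int (- int (p + l) - 1) gchoose q) * (- 1) ^ q)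
      (omult V ((- nu12) ^ l) (\<lambda>e. vcoef u (gen Phi1_p) (gen Phi1_m) (- int (p + q + l) - 1) (vac V)) 0 K))"
  proof -
    let ?g = "\<lambda>l::nat. (- int p - 1, l, q)"
    have inj: "inj ?g" by (auto simp: inj_on_def)
    have 0: "omult V ((- nu12) ^ l) (?Yu (const_ser (vac V)))
        (?e - delta_exp Var_x0 Var_x1 Var_x2 (n, l, i)) K = 0"
      if ne: "(n, l, i) \<notin> range ?g" for n l i
    proof -
      let ?e' = "?e - delta_exp Var_x0 Var_x1 Var_x2 (n, l, i)"
      have "?e' \<noteq> Poly_Mapping.single Var_x1 (Poly_Mapping.lookup ?e' Var_x1)"
      proof
        assume eq: "?e' = Poly_Mapping.single Var_x1 (Poly_Mapping.lookup ?e' Var_x1)"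
        have "n = - int p - 1" "i = q"
          using arg_cong[OF eq, of "\<lambda>e. Poly_Mapping.lookup e Var_x0"]
            arg_cong[OF eq, of "\<lambda>e. Poly_Mapping.lookup e Var_x2"]
          by (simp_all add: delta_exp_def lookup_minus lookup_add lookup_single)
        then show False using ne by auto
      qed
      then show ?thesis by (intro omult_eq_0) (simp only: vop_const_ser if_False)
    qed
    have e': "?e - delta_exp Var_x0 Var_x1 Var_x2 (- int p - 1, l, q) =
        Poly_Mapping.single Var_x1 (int (p + q + l))" for l
      by (rule poly_mapping_eqI)
        (simp add: delta_exp_def lookup_minus lookup_add lookup_single when_def)
    have om: "omult V g (?Yu (const_ser (vac V))) (Poly_Mapping.single Var_x1 m) K =
        omult V g (\<lambda>e. vcoef u (gen Phi1_p) (gen Phi1_m) (- m - 1) (vac V)) 0 K" for g m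
      by (simp add: omult_def vop_const_ser)
    have c: "- of_nat p - 1 - of_nat l = - (of_nat p + of_nat l) - (1 :: complex)" for l
      by simp
    show ?thesis
      unfolding vop_vac
      apply (subst ser_mult_delta, simp, simp, simp)
      apply (subst Sum_any_reindex_inj[OF inj])
      subgoal for a by (cases a, simp only: case_prod_conv, subst 0, assumption, simp)
      apply (simp add: e' om c)
      done
  qed
  \<comment> \<open>Here \<open>Y(u)\<close> on the vacuum would have to supply
    \<open>x_1^(-1-i)\<close>.\<close>
  have T2: "ser_mult V (delta_ser Var_x0 (- 1) Var_x2 (- 1) Var_x1 nu12)
      (?Yv (?Yu (const_ser (vac V)))) ?e K = 0"
  proof -
    have "omult V g (?Yu (const_ser (vac V))) (?e - delta_exp Var_x0 Var_x2 Var_x1 (n, l, i)) K = 0"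
      for g n l i
      by (intro omult_eq_0 vop_const_vac_eq_0)
        (simp add: delta_exp_def lookup_minus lookup_add lookup_single)
    then show ?thesis unfolding vop_vac by (subst ser_mult_delta) (auto intro!: Sum_any.neutral)
  qed
  have T3: "ser_mult V (delta_ser Var_x2 1 Var_x1 (- 1) Var_x0 (- nu12)) ?H ?e K =
    iterate_coef u (vac V) (- int p - 1) (- int q - 1) (vac V) K"
  proof -
    \<comment> \<open>The power \<open>x_1^(-1)\<close> forces \<open>n - l = i - 1\<close>. The
      binomial \<open>i - 1\<close> over \<open>i\<close> vanishes unless \<open>i = 0\<close>, and
      then \<open>l - 1\<close> over \<open>l\<close> vanishes unless \<open>l = 0\<close>.\<close>
    have 0: "csc V (1 powi (- n) * (of_int n gchoose l) * (of_int (n - int l) gchoose i) * (- 1) ^ i)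
        (omult V ((- nu12) ^ l) ?H (?e - delta_exp Var_x2 Var_x1 Var_x0 (n, l, i)) K) = 0"
      if ne: "(n, l, i) \<noteq> (- 1, 0, 0)" for n l i
    proof (cases "n - int l = int i - 1")
      case True
      then have n: "n = int i + int l - 1" by simp
      have "(of_int n gchoose l) * (of_int (n - int l) gchoose i) = (0 :: complex)"
      proof (cases "i = 0")
        case True
        then show ?thesis using ne n gchoose_pred_self[of l] by simp
      next
        case False
        then show ?thesis by (simp add: True gchoose_pred_self del: of_int_diff)
      qed
      then show ?thesis by simp
    next
      case False
      let ?e' = "?e - delta_exp Var_x2 Var_x1 Var_x0 (n, l, i)"
      have "Poly_Mapping.lookup ?e' Var_x1 \<noteq>
            Poly_Mapping.lookup (Poly_Mapping.single Var_x0 (Poly_Mapping.lookup ?e' Var_x0) +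
              Poly_Mapping.single Var_x2 (Poly_Mapping.lookup ?e' Var_x2)) Var_x1"
        using False ne by (simp add: delta_exp_def lookup_minus lookup_add lookup_single)
      then have "?e' \<noteq> Poly_Mapping.single Var_x0 (Poly_Mapping.lookup ?e' Var_x0) +
              Poly_Mapping.single Var_x2 (Poly_Mapping.lookup ?e' Var_x2)"
        by metis
      then have "omult V ((- nu12) ^ l) ?H ?e' K = 0"
        by (intro omult_eq_0) (simp only: vop_ser_iterate if_False)
      then show ?thesis by simp
    qed
    have e': "?e - delta_exp Var_x2 Var_x1 Var_x0 (- 1, 0, 0) =
        Poly_Mapping.single Var_x0 (int p) + Poly_Mapping.single Var_x2 (int q)"
      by (rule poly_mapping_eqI)
        (simp add: delta_exp_def lookup_minus lookup_add lookup_single when_def)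
    show ?thesis
      apply (subst ser_mult_delta, simp, simp, simp)
      apply (subst Sum_any_single[of "(- 1, 0, 0)"])
      subgoal for a by (cases a, simp only: case_prod_conv, rule 0, simp)
      apply (simp add: e' omult_one vop_ser_iterate lookup_add lookup_single)
      done
  qed
  have "ser_mult V (delta_ser Var_x0 1 Var_x1 (- 1) Var_x2 (- nu12))
      (?Yu (?Yv (const_ser (vac V)))) ?e K - csc V (psign (j * 0))
        (ser_mult V (delta_ser Var_x0 (- 1) Var_x2 (- 1) Var_x1 nu12)
      (?Yv (?Yu (const_ser (vac V)))) ?e K) =
      ser_mult V (delta_ser Var_x2 1 Var_x1 (- 1) Var_x0 (- nu12)) ?H ?e K"
    using fun_cong[OF fun_cong[OF Jacobi[OF u vac_even, of "vac V"], of ?e], of K]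
    by (simp add: csc_ser_def)
  then show ?thesis unfolding T1 T2 T3 by simp
qed

section \<open>Vertex operators applied to the vacuum\<close>

lemma iterate_vac_nu_free:
  assumes u: "u \<in> gr V j" and K: "nu_free K"
  shows "iterate_coef u (vac V) (- int p - 1) (- int q - 1) (vac V) K =
    csc V (of_nat ((p + q) choose q)) (vcoef u (gen Phi1_p) (gen Phi1_m) (- int (p + q) - 1) (vac V) K)"
proof -
  have 0: "omult V ((- nu12) ^ l) F e K = 0" if "l \<noteq> 0" for l F e
    using nu_free_mono[OF K] gcoeff_nu12_power_nu_free that by (intro omult_eq_0') auto
  show ?thesis
    unfolding iterate_vac[OF u]
    by (subst Sum_any_single[of 0], simp add: 0)
      (simp only: add_0_right gbinomial_0 mult_1 power_0 omult_one gchoose_neg)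
qed

text \<open>Only the first Taylor term reaches this monomial: \<open>Y(u,(x,phi_1))1\<close> has no
  \<open>phi_2^-\<close>, and higher powers of the shift vanish. The signs of \<open>-nu12\<close>
  and of the binomial \<open>-1\<close> over \<open>1\<close> cancel.\<close>

lemma iterate_vac_nu:
  assumes u: "u \<in> gr V j"
  shows "iterate_coef u (vac V) (- 1) (- 1) (vac V) {Phi1_p, Phi2_m} = md V u (- 2) (vac V)"
proof -
  let ?K = "{Phi1_p, Phi2_m}"
  let ?F = "\<lambda>l e. vcoef u (gen Phi1_p) (gen Phi1_m) (- int l - 1) (vac V)"
  have "gcoeff (gen Phi1_p) ?K = 0" "gcoeff (gen Phi1_m) ?K = 0" "gcoeff (gen Phi1_p * gen Phi1_m) ?K = 0"
    by (auto simp: gcoeff_gen gcoeff_gen_gen)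
  then have 0: "omult V ((- nu12) ^ 0) (?F 0) 0 ?K = 0"
    by (simp add: omult_one vcoef_def)
  have 1: "omult V ((- nu12) ^ 1) (?F 1) 0 ?K = - md V u (- 2) (vac V)"
  proof -
    have "gcoeff nu12 I = (if I = ?K then 1 else 0)" if "I \<subseteq> ?K" for I
      using that by (auto simp: gcoeff_nu12)
    then have "omult V ((- nu12) ^ 1) (?F 1) 0 ?K =
        (\<Sum>I\<in>Pow ?K. if I = ?K then - ?F 1 0 {} else 0)"
      unfolding omult_def by (intro sum.cong) (auto simp: gcoeff_uminus)
    also have "\<dots> = - ?F 1 0 {}" by (subst sum.delta) auto
    finally show ?thesis by (simp add: vcoef_def gcoeff_gen gcoeff_gen_gen)
  qed
  have 2: "omult V ((- nu12) ^ l) (?F l) 0 ?K = 0" if "l \<ge> 2" for l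
    using gcoeff_nu12_power_ge_2[OF that] by (intro omult_eq_0')
  have "omult V ((- nu12) ^ l) (?F l) 0 ?K = 0" if "l \<noteq> 1" for l
    using that 0 2[of l] by (cases "l = 0") auto
  then show ?thesis
    using iterate_vac[OF u, of 0 0 ?K] 1 by (simp add: Sum_any_single[of 1])
qed

lemmas odd_coef_simps = vcoef_def gcoeff_gen gcoeff_gen_gen gcoeff_add gcoeff_diff algebra_simps gsign_singletons

text \<open>Signs arise from the arguments \<open>phi_1 - phi_2\<close> of the inner operator and
  from sorting its odd variables against those of the outer one.\<close>

lemma iterate_coef_eqs:
  "iterate_coef u v n m w {} = md V (md V u n v) m w"
  "iterate_coef u v n m w {Phi1_p} = md V (mdp V u n v) m w"
  "iterate_coef u v n m w {Phi1_m} = md V (mdm V u n v) m w"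
  "iterate_coef u v n m w {Phi1_p, Phi1_m} = md V (mdpm V u n v) m w"
  "iterate_coef u v n m w {Phi2_p} = mdp V (md V u n v) m w - md V (mdp V u n v) m w"
  "iterate_coef u v n m w {Phi2_m} = mdm V (md V u n v) m w - md V (mdm V u n v) m w"
  "iterate_coef u v n m w {Phi2_p, Phi2_m} = mdpm V (md V u n v) m w - mdm V (mdp V u n v) m w
     + mdp V (mdm V u n v) m w + md V (mdpm V u n v) m w"
  "iterate_coef u v n m w {Phi1_p, Phi2_m} = mdm V (mdp V u n v) m w - md V (mdpm V u n v) m w"
  by (simp_all add: iterate_coef_def Pow_insert odd_coef_simps doubleton_eq_iff insert_Diff_if mode_minus_left)

section \<open>The odd and even derivations on modes applied to the vacuum\<close>

lemma mode_vac_minus_one: "md V w (- 1) (vac V) = w"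
  by (rule creation)

text \<open>The coefficient of \<open>phi_2^+ x_2^0\<close> in the composition law, whose right side
  has no \<open>phi_2\<close> at this monomial. For negative \<open>n\<close> both sides vanish by
  creation.\<close>

lemma Dp_mode_vac: "Dp V (md V w (- n - 1) (vac V)) = mdp V w (- n - 1) (vac V)"
proof (rule additive_gr_eqI[of "\<lambda>w. Dp V (md V w (- n - 1) (vac V))"])
  fix p w assume w: "w \<in> gr V p"
  show "Dp V (md V w (- n - 1) (vac V)) = mdp V w (- n - 1) (vac V)"
  proof (cases "n \<ge> 0")
    case True
    then obtain l where "n = int l" using nonneg_int_cases by blast
    then show ?thesis
      using iterate_vac_nu_free[OF w, of "{Phi2_p}" l 0]
      by (simp add: nu_free_def iterate_coef_eqs Dp_def mode_vac_minus_one vcoef_def gcoeff_gen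
          gcoeff_gen_gen)
  qed (simp add: creation Dp_def)
qed (simp_all add: Dp_def mode_add)

lemma Dm_mode_vac: "Dm V (md V w (- n - 1) (vac V)) = mdm V w (- n - 1) (vac V)"
proof (rule additive_gr_eqI[of "\<lambda>w. Dm V (md V w (- n - 1) (vac V))"])
  fix p w assume w: "w \<in> gr V p"
  show "Dm V (md V w (- n - 1) (vac V)) = mdm V w (- n - 1) (vac V)"
  proof (cases "n \<ge> 0")
    case True
    then obtain l where "n = int l" using nonneg_int_cases by blast
    then show ?thesis
      using iterate_vac_nu_free[OF w, of "{Phi2_m}" l 0]
      by (simp add: nu_free_def iterate_coef_eqs Dm_def mode_vac_minus_one vcoef_def gcoeff_gen
          gcoeff_gen_gen)
  qed (simp add: creation Dm_def)
qed (simp_all add: Dm_def mode_add)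

text \<open>The coefficient of \<open>phi_2^+ phi_2^- x_2^0\<close> gives a relation with an
  unwanted term \<open>?F\<close>. It is used twice, for \<open>w\<close> and for \<open>?A\<close>,
  to eliminate \<open>?F\<close>.\<close>

lemma Dm_Dp_mode_vac:
  "Dm V (mdp V w (- n - 1) (vac V)) - Dp V (mdm V w (- n - 1) (vac V)) =
    csc V 2 (mdpm V w (- n - 1) (vac V))"
proof (rule additive_gr_eqI[of "\<lambda>w. Dm V (mdp V w (- n - 1) (vac V)) - Dp V (mdm V w (- n - 1) (vac V))"])
  fix p w assume w: "w \<in> gr V p"
  have *: "mdpm V (md V w (- int l - 1) (vac V)) (- 1) (vac V) - Dm V (mdp V w (- int l - 1) (vac V))
      + Dp V (mdm V w (- int l - 1) (vac V)) + mdpm V w (- int l - 1) (vac V) = 0"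
    if "w \<in> gr V q" for w q l
    using iterate_vac_nu_free[OF that, of "{Phi2_p, Phi2_m}" l 0]
    by (simp add: nu_free_def iterate_coef_eqs Dp_def Dm_def mode_vac_minus_one vcoef_def gcoeff_gen
          gcoeff_gen_gen doubleton_eq_iff)
  show "Dm V (mdp V w (- n - 1) (vac V)) - Dp V (mdm V w (- n - 1) (vac V)) =
      csc V 2 (mdpm V w (- n - 1) (vac V))"
  proof (cases "n \<ge> 0")
    case True
    then obtain l where n: "n = int l" using nonneg_int_cases by blast
    let ?A = "md V w (- n - 1) (vac V)" and ?E = "mdpm V w (- n - 1) (vac V)"
    let ?X = "Dm V (mdp V w (- n - 1) (vac V)) - Dp V (mdm V w (- n - 1) (vac V))"
    let ?F = "mdpm V ?A (- 1) (vac V)"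
    have A: "?A \<in> gr V (p + 0)"
      using End_part_gr[OF mode_End(1)[OF w] vac_even] .
    have 1: "?E = ?X - ?F"
      using *[OF w, of l] by (simp add: n algebra_simps)
    \<comment> \<open>The relation for \<open>?A\<close> at mode -1: there \<open>?A\<close>
      reproduces itself and its odd modes are those of \<open>w\<close>, so both \<open>mdpm\<close>
      terms are \<open>?F\<close>.\<close>
    have 2: "?X = ?F + ?F"
    proof -
      have "mdp V ?A (- 1) (vac V) = mdp V w (- n - 1) (vac V)"
        using Dp_mode_vac[of w n] by (simp add: Dp_def)
      moreover have "mdm V ?A (- 1) (vac V) = mdm V w (- n - 1) (vac V)"
        using Dm_mode_vac[of w n] by (simp add: Dm_def)
      ultimately show ?thesis
        using *[OF A, of 0] by (simp add: mode_vac_minus_one algebra_simps)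
    qed
    have "?F = ?E" unfolding 1 2 by simp
    with 2 have "?X = ?E + ?E" by simp
    then have "?X = csc V (1 + 1) ?E" by (simp only: cvs.scale_left_distrib cvs.scale_one)
    then show ?thesis by simp
  qed (simp add: creation Dp_def Dm_def)
qed (simp_all add: Dp_def Dm_def mode_add cvs.scale_right_distrib)

text \<open>The coefficient of \<open>phi_1^+ phi_2^-\<close> gives
  \<open>w_(-2) 1 = D^- D^+ w - E\<close>, where \<open>2 E = D^- D^+ w - D^+ D^- w\<close>. This is
  half the anticommutator, the supercommutator of two odd maps.\<close>

lemma DD_eq: "DD V w = md V w (- 2) (vac V)"
proof (rule additive_gr_eqI[of "DD V"])
  fix p w assume w: "w \<in> gr V p"
  let ?E = "mdpm V w (- 1) (vac V)"
  have 1: "md V w (- 2) (vac V) = Dm V (Dp V w) - ?E"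
    using iterate_vac_nu[OF w]
    by (simp add: iterate_coef_eqs Dp_def Dm_def mode_vac_minus_one)
  have 2: "Dm V (Dp V w) - Dp V (Dm V w) = csc V 2 ?E"
    using Dm_Dp_mode_vac[of w 0] by (simp add: Dp_def Dm_def)
  have "csc V (1 / 2) (Dm V (Dp V w) - Dp V (Dm V w)) = ?E" unfolding 2 by simp
  then have "md V w (- 2) (vac V) = csc V (1 / 2 + 1 / 2) (Dm V (Dp V w)) -
      csc V (1 / 2) (Dm V (Dp V w) - Dp V (Dm V w))"
    using 1 by simp
  also have "\<dots> = csc V (1 / 2) (Dp V (Dm V w) + Dm V (Dp V w))"
    by (simp only: cvs.scale_left_distrib cvs.scale_right_distrib cvs.scale_right_diff_distrib)
      (simp add: algebra_simps)
  also have "\<dots> = DD V w" by (simp add: DD_def supercommutator_def psign_def)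
  finally show "DD V w = md V w (- 2) (vac V)" ..
qed (simp_all add: DD_def supercommutator_def Dp_def Dm_def mode_add cvs.scale_right_distrib
    cvs.scale_right_diff_distrib algebra_simps)

text \<open>The part linear in \<open>x_2\<close> of the composition law, with factor
  \<open>n + 1\<close> over \<open>1\<close>. At \<open>n = -1\<close> the factor is 0; below that
  creation kills both sides.\<close>

lemma DD_mode_vac:
  "DD V (md V w (- n - 1) (vac V)) = csc V (of_int (n + 1)) (md V w (- n - 2) (vac V))"
  "DD V (mdp V w (- n - 1) (vac V)) = csc V (of_int (n + 1)) (mdp V w (- n - 2) (vac V))"
  "DD V (mdm V w (- n - 1) (vac V)) = csc V (of_int (n + 1)) (mdm V w (- n - 2) (vac V))"
  "DD V (mdpm V w (- n - 1) (vac V)) = csc V (of_int (n + 1)) (mdpm V w (- n - 2) (vac V))"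
proof -
  consider l where "n = int l" | "n = - 1" | "n < - 1"
    using nonneg_int_cases[of n] by fastforce
  then have "DD V (md V w (- n - 1) (vac V)) = csc V (of_int (n + 1)) (md V w (- n - 2) (vac V)) \<and>
    DD V (mdp V w (- n - 1) (vac V)) = csc V (of_int (n + 1)) (mdp V w (- n - 2) (vac V)) \<and>
    DD V (mdm V w (- n - 1) (vac V)) = csc V (of_int (n + 1)) (mdm V w (- n - 2) (vac V)) \<and>
    DD V (mdpm V w (- n - 1) (vac V)) = csc V (of_int (n + 1)) (mdpm V w (- n - 2) (vac V))"
  proof cases
    case (1 l)
    have idx: "- int (l + 1) - 1 = - int l - 2" "- int (1::nat) - 1 = - 2" by simp_all
    have free: "nu_free {}" "nu_free {Phi1_p}" "nu_free {Phi1_m}" "nu_free {Phi1_p, Phi1_m}"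
      by (auto simp: nu_free_def)
    have hom: "DD V (md V w (- n - 1) (vac V)) = csc V (of_int (n + 1)) (md V w (- n - 2) (vac V))"
      "DD V (mdp V w (- n - 1) (vac V)) = csc V (of_int (n + 1)) (mdp V w (- n - 2) (vac V))"
      "DD V (mdm V w (- n - 1) (vac V)) = csc V (of_int (n + 1)) (mdm V w (- n - 2) (vac V))"
      "DD V (mdpm V w (- n - 1) (vac V)) = csc V (of_int (n + 1)) (mdpm V w (- n - 2) (vac V))"
      if "w \<in> gr V p" for w p
      using free[THEN iterate_vac_nu_free[OF that, of _ l 1]]
      unfolding idx DD_eq iterate_coef_eqs
      by (simp_all add: 1 vcoef_def gcoeff_gen gcoeff_gen_gen doubleton_eq_iff add.commute)
    have "DD V (md V w (- n - 1) (vac V)) = csc V (of_int (n + 1)) (md V w (- n - 2) (vac V))"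
      by (rule additive_gr_eqI[of "\<lambda>w. DD V (md V w (- n - 1) (vac V))"])
        (simp add: DD_eq mode_add, simp only: mode_add cvs.scale_right_distrib, erule hom)
    moreover have "DD V (mdp V w (- n - 1) (vac V)) = csc V (of_int (n + 1)) (mdp V w (- n - 2) (vac V))"
      by (rule additive_gr_eqI[of "\<lambda>w. DD V (mdp V w (- n - 1) (vac V))"])
        (simp add: DD_eq mode_add, simp only: mode_add cvs.scale_right_distrib, erule hom)
    moreover have "DD V (mdm V w (- n - 1) (vac V)) = csc V (of_int (n + 1)) (mdm V w (- n - 2) (vac V))"
      by (rule additive_gr_eqI[of "\<lambda>w. DD V (mdm V w (- n - 1) (vac V))"])
        (simp add: DD_eq mode_add, simp only: mode_add cvs.scale_right_distrib, erule hom)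
    moreover have "DD V (mdpm V w (- n - 1) (vac V)) = csc V (of_int (n + 1)) (mdpm V w (- n - 2) (vac V))"
      by (rule additive_gr_eqI[of "\<lambda>w. DD V (mdpm V w (- n - 1) (vac V))"])
        (simp add: DD_eq mode_add, simp only: mode_add cvs.scale_right_distrib, erule hom)
    ultimately show ?thesis by blast
  next
    case 2
    then show ?thesis by (simp add: creation DD_eq)
  next
    case 3
    then show ?thesis by (simp add: creation DD_eq)
  qed
  then show "DD V (md V w (- n - 1) (vac V)) = csc V (of_int (n + 1)) (md V w (- n - 2) (vac V))"
    "DD V (mdp V w (- n - 1) (vac V)) = csc V (of_int (n + 1)) (mdp V w (- n - 2) (vac V))"
    "DD V (mdm V w (- n - 1) (vac V)) = csc V (of_int (n + 1)) (mdm V w (- n - 2) (vac V))"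
    "DD V (mdpm V w (- n - 1) (vac V)) = csc V (of_int (n + 1)) (mdpm V w (- n - 2) (vac V))"
    by blast+
qed

section \<open>The exponential\<close>

text \<open>At \<open>phi^+ phi^-\<close>, \<open>D^+\<close> passes \<open>phi^-\<close> and gets a
  minus sign. \<open>D^-\<close> passes \<open>phi^+\<close>, and \<open>phi^-\<close> is sorted
  behind \<open>phi^+\<close>, so its two signs cancel.\<close>

lemma Dgen_coef:
  "Dgen V F e {} = DD V (F (e - Poly_Mapping.single Var_x 1) {})"
  "Dgen V F e {Phi_p} = DD V (F (e - Poly_Mapping.single Var_x 1) {Phi_p}) + Dp V (F e {})"
  "Dgen V F e {Phi_m} = DD V (F (e - Poly_Mapping.single Var_x 1) {Phi_m}) + Dm V (F e {})"
  "Dgen V F e {Phi_p, Phi_m} = DD V (F (e - Poly_Mapping.single Var_x 1) {Phi_p, Phi_m})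
     - Dp V (F e {Phi_m}) + Dm V (F e {Phi_p})"
  by (simp_all add: Dgen_def xmult_def omult_def End_ser_def Pow_insert gcoeff_gen gsign_singletons
      insert_Diff_if psign_def doubleton_eq_iff algebra_simps)

lemma Dgen_eq_0:
  assumes "\<And>I. I \<subseteq> K \<Longrightarrow> F e I = 0" "F (e - Poly_Mapping.single Var_x 1) K = 0"
  shows "Dgen V F e K = 0"
  using assms
  by (simp add: Dgen_def xmult_def omult_eq_0 End_ser_def DD_eq Dp_def Dm_def)

lemma Dp_additive: "Dp V (v + w) = Dp V v + Dp V w" "Dp V (v - w) = Dp V v - Dp V w"
    "Dp V (csc V c v) = csc V c (Dp V v)"
  and Dm_additive: "Dm V (v + w) = Dm V v + Dm V w" "Dm V (v - w) = Dm V v - Dm V w"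
    "Dm V (csc V c v) = csc V c (Dm V v)"
  and DD_additive: "DD V (v + w) = DD V v + DD V w" "DD V (v - w) = DD V v - DD V w"
    "DD V (csc V c v) = csc V c (DD V v)"
  using mode_add[of v "- w"]
  by (simp_all add: Dp_def Dm_def DD_eq mode_add mode_csc_left mode_minus_left)

text \<open>All of \<open>x\<close>, \<open>phi^+\<close>, \<open>phi^-\<close> have degree 1, so
  the modes of \<open>P\<close> in degree \<open>n\<close> sit at powers \<open>x^n\<close>,
  \<open>x^(n-1)\<close> and \<open>x^(n-2)\<close>. In the induction each term collects
  \<open>n + 1\<close>: as \<open>n\<close> plus 1 for one odd variable, as \<open>n - 1\<close>
  plus 2 for two.\<close>

lemma Dgen_power_coef:
  "(Dgen V ^^ n) F e {} = csc V (fact n)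
     (md V (F (e - Poly_Mapping.single Var_x (int n)) {}) (- int n - 1) (vac V))"
  "(Dgen V ^^ n) F e {Phi_p} = csc V (fact n)
     (md V (F (e - Poly_Mapping.single Var_x (int n)) {Phi_p}) (- int n - 1) (vac V)
      + mdp V (F (e - Poly_Mapping.single Var_x (int n - 1)) {}) (- int n) (vac V))"
  "(Dgen V ^^ n) F e {Phi_m} = csc V (fact n)
     (md V (F (e - Poly_Mapping.single Var_x (int n)) {Phi_m}) (- int n - 1) (vac V)
      + mdm V (F (e - Poly_Mapping.single Var_x (int n - 1)) {}) (- int n) (vac V))"
  "(Dgen V ^^ n) F e {Phi_p, Phi_m} = csc V (fact n)
     (md V (F (e - Poly_Mapping.single Var_x (int n)) {Phi_p, Phi_m}) (- int n - 1) (vac V)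
      - mdp V (F (e - Poly_Mapping.single Var_x (int n - 1)) {Phi_m}) (- int n) (vac V)
      + mdm V (F (e - Poly_Mapping.single Var_x (int n - 1)) {Phi_p}) (- int n) (vac V)
      + mdpm V (F (e - Poly_Mapping.single Var_x (int n - 2)) {}) (1 - int n) (vac V))"
proof (induction n arbitrary: e)
  \<comment> \<open>The terms beyond the first are modes of index 0 or 1 on the vacuum, which vanish
    by creation.\<close>
  case 0
  { case 1 show ?case by (simp add: mode_vac_minus_one)
  next case 2 show ?case by (simp add: mode_vac_minus_one creation)
  next case 3 show ?case by (simp add: mode_vac_minus_one creation)
  next case 4 show ?case by (simp add: mode_vac_minus_one creation) }
next
  case (Suc n)
  have e: "e - Poly_Mapping.single Var_x 1 - Poly_Mapping.single Var_x m =
      e - Poly_Mapping.single Var_x (m + 1)" for e :: evexp and m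
    by (simp add: diff_diff_eq add.commute flip: single_add)
  have fact: "fact (Suc n) = (fact n * of_int (int n + 1) :: complex)"
    by (simp add: algebra_simps)
  note D = DD_mode_vac[of _ "int n"] DD_mode_vac[of _ "int n - 1"] DD_mode_vac[of _ "int n - 2"]
    Dp_mode_vac[of _ "int n"] Dm_mode_vac[of _ "int n"]
  \<comment> \<open>Solved for the \<open>Dm\<close> term, so that the \<open>Dp\<close> terms
    cancel and the factor 2 of \<open>mdpm\<close> remains.\<close>
  have DmDp: "Dm V (mdp V w (- int n) (vac V)) =
      mdpm V w (- int n) (vac V) + mdpm V w (- int n) (vac V) + Dp V (mdm V w (- int n) (vac V))" for w
    using Dm_Dp_mode_vac[of w "int n - 1"] cvs.scale_left_distrib[of 1 1 "mdpm V w (- int n) (vac V)"]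
    by (simp add: algebra_simps)
  have idx: "- (int n - 1) - 1 = - int n" "- (int n - 1) - 2 = - int n - 1"
    "- (int n - 2) - 1 = 1 - int n" "- (int n - 2) - 2 = - int n" "- int (Suc n) - 1 = - int n - 2"
    "- int (Suc n) = - int n - 1" "1 - int (Suc n) = - int n"
    "int n - 1 + 1 = int n" "int n - 2 + 1 = int n - 1" "int (Suc n) = int n + 1"
    "int n + 1 - 1 = int n" "int n + 1 - 2 = int n - 1" "- (int n + 1) = - int n - 1"
    "1 - (int n + 1) = - int n" "- int n - 1 - 1 = - int n - 2"
    by simp_all
  note rules = funpow.simps o_apply Dgen_coef Suc.IH DD_additive Dp_additive Dm_additive e
    D[unfolded idx] DmDp idx fact
  { case 1 show ?case by (simp only: rules) (simp add: cvs.scale_right_distrib)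
  next case 2 show ?case
      apply (simp only: rules)
      apply (simp add: cvs.scale_right_distrib cvs.scale_left_distrib algebra_simps)
      done
  next case 3 show ?case
      apply (simp only: rules)
      apply (simp add: cvs.scale_right_distrib cvs.scale_left_distrib algebra_simps)
      done
  next case 4 show ?case
      apply (simp only: rules)
      apply (simp add: cvs.scale_right_distrib cvs.scale_left_distrib algebra_simps)
      done }
qed

lemma Dgen_power_eq_0:
  assumes F: "\<And>e K. \<not> K \<subseteq> {Phi_p, Phi_m} \<or> e \<notin> range (Poly_Mapping.single Var_x) \<Longrightarrow> F e K = 0"
    and K: "\<not> K \<subseteq> {Phi_p, Phi_m} \<or> e \<notin> range (Poly_Mapping.single Var_x)"
  shows "(Dgen V ^^ n) F e K = 0"
  using K
proof (induction n arbitrary: e K)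
  case 0
  then show ?case using F by simp
next
  case (Suc n)
  have e: "e - Poly_Mapping.single Var_x 1 \<notin> range (Poly_Mapping.single Var_x)"
    if "e \<notin> range (Poly_Mapping.single Var_x)"
  proof
    assume "e - Poly_Mapping.single Var_x 1 \<in> range (Poly_Mapping.single Var_x)"
    then obtain m where "e - Poly_Mapping.single Var_x 1 = Poly_Mapping.single Var_x m" by auto
    then have "e = Poly_Mapping.single Var_x (m + 1)"
      by (simp add: single_add algebra_simps)
    then show False using that by blast
  qed
  show ?case
  proof (cases "K \<subseteq> {Phi_p, Phi_m}")
    case True
    then show ?thesis using Suc e unfolding funpow.simps o_apply by (intro Dgen_eq_0) auto
  next
    case False
    have om: "omult V (gen i) G e K = 0"
      if G: "\<And>I. \<not> I \<subseteq> {Phi_p, Phi_m} \<Longrightarrow> G e I = 0" and i: "i \<in> {Phi_p, Phi_m}" for i and G :: "'v fser"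
      unfolding omult_def
    proof (rule sum.neutral, rule ballI)
      fix I assume "I \<in> Pow K"
      have "\<not> K - I \<subseteq> {Phi_p, Phi_m}" if "I = {i}" using that i False by auto
      then show "csc V (gsign I (K - I) * gcoeff (gen i) I) (G e (K - I)) = 0"
        using G by (auto simp: gcoeff_gen)
    qed
    show ?thesis
      using Suc.IH False
      by (simp add: Dgen_def xmult_def om End_ser_def DD_eq Dp_def Dm_def)
  qed
qed

lemma csc_Sum_any: "c \<noteq> 0 \<Longrightarrow> csc V c (Sum_any f) = Sum_any (\<lambda>i. csc V c (f i))"
  unfolding Sum_any.expand_set by (simp add: cvs.scale_sum_right)

text \<open>The factorials cancel, which leaves \<open>P(x,phi)\<close> applied to \<open>F\<close>.
  Truncation makes each sum finite, so the four kinds of modes can be summed and reindexed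
  separately.\<close>

lemma exp_Dgen_coef:
  fixes f :: "int \<Rightarrow> ovar set \<Rightarrow> 'v"
  assumes F: "\<And>m. F (Poly_Mapping.single Var_x m) = f m" and trunc: "\<forall>m K. m < M \<longrightarrow> f m K = 0"
  shows "exp_ser V (Dgen V) F (Poly_Mapping.single Var_x a) {} =
      Sum_any (\<lambda>n::nat. md V (f (a - int n) {}) (- int n - 1) (vac V))" (is ?th1)
    and "exp_ser V (Dgen V) F (Poly_Mapping.single Var_x a) {Phi_p} =
      Sum_any (\<lambda>n::nat. md V (f (a - int n) {Phi_p}) (- int n - 1) (vac V) +
        mdp V (f (a - int n) {}) (- int n - 1) (vac V))" (is ?th2)
    and "exp_ser V (Dgen V) F (Poly_Mapping.single Var_x a) {Phi_m} =
      Sum_any (\<lambda>n::nat. md V (f (a - int n) {Phi_m}) (- int n - 1) (vac V) +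
        mdm V (f (a - int n) {}) (- int n - 1) (vac V))" (is ?th3)
    and "exp_ser V (Dgen V) F (Poly_Mapping.single Var_x a) {Phi_p, Phi_m} =
      Sum_any (\<lambda>n::nat. md V (f (a - int n) {Phi_p, Phi_m}) (- int n - 1) (vac V) -
        mdp V (f (a - int n) {Phi_m}) (- int n - 1) (vac V) +
        mdm V (f (a - int n) {Phi_p}) (- int n - 1) (vac V) +
        mdpm V (f (a - int n) {}) (- int n - 1) (vac V))" (is ?th4)
proof -
  \<comment> \<open>\<open>k\<close> is the number of odd variables taken from \<open>P\<close>, by
    which its power of \<open>x\<close> falls short of the degree \<open>n\<close>.\<close>
  define S where "S g k = Sum_any (\<lambda>n::nat. g (f (a - (int n - k))) (- int n - 1 + k) :: 'v)"
    for g :: "(ovar set \<Rightarrow> 'v) \<Rightarrow> int \<Rightarrow> 'v" and k :: int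
  \<comment> \<open>The \<open>k\<close> terms dropped by reindexing are modes of nonnegative index,
    zero by creation.\<close>
  have shift: "S g (int k) = S g 0" if "\<And>h m. m \<ge> 0 \<Longrightarrow> g h m = 0" for g k
  proof -
    have "S g (int k) = Sum_any (\<lambda>n::nat. g (f (a - (int (n + k) - int k))) (- int (n + k) - 1 + int k))"
      unfolding S_def
    proof (rule Sum_any_reindex_inj)
      fix n assume "n \<notin> range (\<lambda>n. n + k)"
      then have "n < k" by (metis le_add_diff_inverse2 not_le rangeI)
      then show "g (f (a - (int n - int k))) (- int n - 1 + int k) = 0" by (intro that) simp
    qed simp
    then show ?thesis by (simp add: S_def)
  qed
  have fin: "finite {n. g (f (a - (int n - k))) (- int n - 1 + k) \<noteq> 0}"
    if "\<And>m. g (\<lambda>K. 0) m = 0" for g and k :: int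
  proof (rule finite_subset)
    show "{n. g (f (a - (int n - k))) (- int n - 1 + k) \<noteq> 0} \<subseteq> {.. nat (a + k - M)}"
    proof
      fix n assume n: "n \<in> {n. g (f (a - (int n - k))) (- int n - 1 + k) \<noteq> 0}"
      have "\<not> a - (int n - k) < M"
      proof
        assume "a - (int n - k) < M"
        then have "f (a - (int n - k)) = (\<lambda>K. 0)" using trunc by blast
        with n that show False by simp
      qed
      then show "n \<in> {.. nat (a + k - M)}" by auto
    qed
  qed simp
  have sub: "Poly_Mapping.single Var_x a - Poly_Mapping.single Var_x m = Poly_Mapping.single Var_x (a - m)" for m
    by (simp flip: single_diff)
  note exp = exp_ser_def Dgen_power_coef sub F cvs.scale_scale
  have add: "Sum_any (\<lambda>n. g n + h n) = Sum_any g + Sum_any h"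
    if "finite {n. g n \<noteq> 0}" "finite {n. h n \<noteq> 0}" for g h :: "nat \<Rightarrow> 'v"
    using that by (rule Sum_any.distrib)
  show ?th1 by (simp add: exp)
  let ?A = "\<lambda>K h m. md V (h K) m (vac V)" and ?B = "\<lambda>K h m. mdp V (h K) m (vac V)"
    and ?B' = "\<lambda>K h m. - mdp V (h K) m (vac V)"
    and ?C = "\<lambda>K h m. mdm V (h K) m (vac V)" and ?E = "\<lambda>K h m. mdpm V (h K) m (vac V)"
  have "exp_ser V (Dgen V) F (Poly_Mapping.single Var_x a) {Phi_p} = S (?A {Phi_p}) 0 + S (?B {}) (int 1)"
    unfolding S_def by (subst add[symmetric, OF fin fin]) (simp_all add: exp)
  also have "\<dots> = S (?A {Phi_p}) 0 + S (?B {}) 0"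
    by (subst shift) (simp_all add: creation)
  finally show ?th2
    unfolding S_def by (subst (asm) add[symmetric, OF fin fin]) simp_all
  have "exp_ser V (Dgen V) F (Poly_Mapping.single Var_x a) {Phi_m} = S (?A {Phi_m}) 0 + S (?C {}) (int 1)"
    unfolding S_def by (subst add[symmetric, OF fin fin]) (simp_all add: exp)
  also have "\<dots> = S (?A {Phi_m}) 0 + S (?C {}) 0"
    by (subst shift) (simp_all add: creation)
  finally show ?th3
    unfolding S_def by (subst (asm) add[symmetric, OF fin fin]) simp_all
  have fin_add: "finite {n. g n + h n \<noteq> 0}"
    if "finite {n. g n \<noteq> 0}" "finite {n. h n \<noteq> 0}" for g h :: "nat \<Rightarrow> 'v"
    by (rule finite_subset[OF _ finite_UnI[OF that]]) auto
  have four: "S (?A K1) 0 + S (?B' K2) k + S (?C K3) k + S (?E K4) l = Sum_any (\<lambda>n.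
      ?A K1 (f (a - (int n - 0))) (- int n - 1 + 0) + ?B' K2 (f (a - (int n - k))) (- int n - 1 + k) +
      ?C K3 (f (a - (int n - k))) (- int n - 1 + k) + ?E K4 (f (a - (int n - l))) (- int n - 1 + l))"
    for K1 K2 K3 K4 k l
  proof -
    have "finite {n. ?A K1 (f (a - (int n - 0))) (- int n - 1 + 0) \<noteq> 0}"
      using fin[of "?A K1" 0] by simp
    moreover have "finite {n. ?B' K2 (f (a - (int n - k))) (- int n - 1 + k) \<noteq> 0}"
      using fin[of "?B' K2" k] by simp
    moreover have "finite {n. ?C K3 (f (a - (int n - k))) (- int n - 1 + k) \<noteq> 0}"
      using fin[of "?C K3" k] by simp
    moreover have "finite {n. ?E K4 (f (a - (int n - l))) (- int n - 1 + l) \<noteq> 0}"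
      using fin[of "?E K4" l] by simp
    ultimately show ?thesis by (simp only: S_def add fin_add)
  qed
  have "exp_ser V (Dgen V) F (Poly_Mapping.single Var_x a) {Phi_p, Phi_m} =
      S (?A {Phi_p, Phi_m}) 0 + S (?B' {Phi_m}) (int 1) + S (?C {Phi_p}) (int 1) + S (?E {}) (int 2)"
    unfolding four by (simp add: exp)
  also have "\<dots> = S (?A {Phi_p, Phi_m}) 0 + S (?B' {Phi_m}) 0 + S (?C {Phi_p}) 0 + S (?E {}) 0"
    by (simp only: shift creation neg_equal_0_iff_equal)
  finally show ?th4 unfolding four by simp
qed

lemma skew_supersymmetry:
  assumes u: "u \<in> gr V j" and v: "v \<in> gr V k"
  shows "vop V j u 1 Var_x (gen Phi_p) (gen Phi_m) (const_ser v) =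
    csc_ser V (psign (j * k))
      (exp_ser V (Dgen V)
        (vop V k v (- 1) Var_x (- gen Phi_p) (- gen Phi_m) (const_ser u)))"
proof (rule ext, rule ext)
  fix e K
  let ?F = "vop V k v (- 1) Var_x (- gen Phi_p) (- gen Phi_m) (const_ser u)"
  define f where "f m = (\<lambda>K. csc V ((- 1) powi m) (vcoef v (- gen Phi_p) (- gen Phi_m) (- m - 1) u K))" for m
  have F: "?F (Poly_Mapping.single Var_x m) = f m" for m
    by (rule ext) (simp add: vop_const_ser f_def)
  show "vop V j u 1 Var_x (gen Phi_p) (gen Phi_m) (const_ser v) e K =
    csc_ser V (psign (j * k)) (exp_ser V (Dgen V) ?F) e K"
  proof (cases "K \<subseteq> {Phi_p, Phi_m} \<and> e \<in> range (Poly_Mapping.single Var_x)")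
    case False
    have 0: "vop V p w c Var_x \<theta>p \<theta>m (const_ser z) e K = 0"
      if "\<not> K \<subseteq> {Phi_p, Phi_m} \<or> e \<notin> range (Poly_Mapping.single Var_x)"
        "\<theta>p \<in> {gen Phi_p, - gen Phi_p}" "\<theta>m \<in> {gen Phi_m, - gen Phi_m}" for p w c \<theta>p \<theta>m z e K
    proof (cases "e = Poly_Mapping.single Var_x (Poly_Mapping.lookup e Var_x)")
      case True
      then have "\<not> K \<subseteq> {Phi_p, Phi_m}" using that(1) by (metis rangeI)
      then have "K \<noteq> {}" "K \<noteq> {Phi_p}" "K \<noteq> {Phi_m}" "K \<noteq> {Phi_p, Phi_m}" by auto
      then have "gcoeff (gen Phi_p) K = 0" "gcoeff (gen Phi_m) K = 0"
        "gcoeff (gen Phi_p * gen Phi_m) K = 0" "K \<noteq> {}"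
        by (simp_all add: gcoeff_gen gcoeff_gen_gen)
      then have "vcoef w \<theta>p \<theta>m n z K = 0" for n
        using that(2,3) by (elim insertE emptyE) (simp_all add: vcoef_def gcoeff_uminus)
      then show ?thesis by (simp only: vop_const_ser cvs.scale_zero_right if_cancel)
    next
      case False
      then show ?thesis by (simp only: vop_const_ser if_False)
    qed
    have "(Dgen V ^^ n) ?F e K = 0" for n
      using False by (intro Dgen_power_eq_0 0) auto
    then show ?thesis using False by (simp add: csc_ser_def exp_ser_def 0)
  next
    case True
    then obtain a where e: "e = Poly_Mapping.single Var_x a" by auto
    obtain N where N: "\<And>n. n \<ge> N \<Longrightarrow> md V v n u = 0 \<and> mdp V v n u = 0 \<and> mdm V v n u = 0 \<and> mdpm V v n u = 0"
      using truncation by blast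
    \<comment> \<open>\<open>m < - N\<close> means that the mode index \<open>- m - 1\<close> is at
      least \<open>N\<close>.\<close>
    have trunc: "\<forall>m K. m < - N \<longrightarrow> f m K = 0"
      using N by (simp add: f_def vcoef_def)
    \<comment> \<open>The vacuum identity with \<open>u\<close> and \<open>v\<close> exchanged,
      multiplied by its own sign. The factors \<open>(-1)^a\<close> and \<open>(-1)^i\<close>
      combine to the \<open>(-1)^(a-i)\<close> of \<open>Y(v,(-x,...))\<close>.\<close>
    have iter: "vcoef u (gen Phi2_p) (gen Phi2_m) (- a - 1) v K = csc V (psign (j * k))
        (Sum_any (\<lambda>i::nat. csc V ((- 1) powi (a - int i)) (iterate_coef v u (int i - a - 1) (- int i - 1) (vac V) K)))"
      if "K \<subseteq> {Phi2_p, Phi2_m}" for K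
    proof -
      have "csc V (psign (j * k)) (csc V ((- 1) powi a)
          (Sum_any (\<lambda>i::nat. csc V ((- 1) ^ i) (iterate_coef v u (int i - a - 1) (- int i - 1) (vac V) K)))) =
        vcoef u (gen Phi2_p) (gen Phi2_m) (- a - 1) v K"
        unfolding iterate_sum_eq_vcoef[OF v u that]
        by (simp add: psign_def mult.commute[of k j] power_int_mult_distrib[symmetric])
      moreover have "(- 1) powi a * (- 1) ^ i = ((- 1) powi (a - int i) :: complex)" for i
        by (cases "even i") (simp_all add: power_int_diff)
      ultimately show ?thesis by (simp add: csc_Sum_any)
    qed
    have pm: "{Phi_p, Phi_m} \<noteq> {Phi_p}" "{Phi_p, Phi_m} \<noteq> {Phi_m}" "{Phi2_p, Phi2_m} \<noteq> {Phi2_p}"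
      "{Phi2_p, Phi2_m} \<noteq> {Phi2_m}" by auto
    note coef = csc_ser_def vop_const_ser F vcoef_def gcoeff_gen gcoeff_gen_gen gcoeff_uminus f_def pm
      mode_csc_left mode_minus_left iterate_coef_eqs cvs.scale_right_distrib
      cvs.scale_right_diff_distrib algebra_simps
    note exp = exp_Dgen_coef[of ?F f "- N", OF F trunc]
    \<comment> \<open>At \<open>phi_1 = 0\<close> the inner operator has odd arguments
      \<open>-phi_2\<close>, just as \<open>Y(v,(-x,-phi^+,-phi^-))\<close> has \<open>-phi\<close>.
      Renaming \<open>phi_2\<close> to \<open>phi\<close> matches the sums monomial by
      monomial.\<close>
    consider "K = {}" | "K = {Phi_p}" | "K = {Phi_m}" | "K = {Phi_p, Phi_m}"
      using True by blast
    then show ?thesis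
    proof cases
      case 1
      then show ?thesis using iter[of "{}"]
        unfolding e 1 csc_ser_def exp by (simp add: coef)
    next
      case 2
      then show ?thesis using iter[of "{Phi2_p}"]
        unfolding e 2 csc_ser_def exp by (simp add: coef)
    next
      case 3
      then show ?thesis using iter[of "{Phi2_m}"]
        unfolding e 3 csc_ser_def exp by (simp add: coef)
    next
      case 4
      then show ?thesis using iter[of "{Phi2_p, Phi2_m}"]
        unfolding e 4 csc_ser_def exp by (simp add: coef)
    qed
  qed
qed

end

theorem proposition2p7:
  fixes L :: enat and V :: "('v::ab_group_add) n2_data"
  assumes "N2_vertex_superalgebra L V" and "u \<in> gr V j" and "v \<in> gr V k"
  shows "vop V j u 1 Var_x (gen Phi_p) (gen Phi_m) (const_ser v) =
    csc_ser V (psign (j * k))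
      (exp_ser V (Dgen V)
        (vop V k v (- 1) Var_x (- gen Phi_p) (- gen Phi_m) (const_ser u)))"
  using assms by (rule N2_vertex_superalgebra.skew_supersymmetry)

end
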